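(* Let $n\ge1$. For all $k\in\{0,1,\dots,n\}$, all $f:\{-1,1\}^n\to[-1,1]$, and all $p\in[1,2)$, $$\max_{J\subseteq[n]:|J|=k}\|D_Jf\|_{L^p}^{p}\ \ge\ C(p)^k\,\frac{W^{\ge k}(f)}{\binom nk}\left[1+\frac{1}{2k}\ln\left(\frac{\binom nk}{W^{\ge k}(f)}\right)\right]^{k},\qquad C(p)=\Big(1+\frac{1}{e(2-p)}\Big)^{-1}.$$ Moreover there is an absolute constant $c>0$ with $C(p)\ge c\,(2-p)$ for all $p\in[1,2)$.
   Context: The cube $\{-1,1\}^n$ carries the uniform probability measure; $L^p$ norms and the $L^2$ inner product are with respect to it. For $f:\{-1,1\}^n\to\mathbb R$ and $i\in[n]=\{1,\dots,n\}$, $D_i f(x)=\frac{1}{2}\big(f(x^{(i\mapsto 1)})-f(x^{(i\mapsto -1)})\big)$, where $x^{(i\mapsto\pm1)}$ is $x$ with its $i$-th coordinate replaced by $\pm1$. For $J\subseteq[n]$, $D_J:=\prod_{i\in J}D_i$, with $D_\varnothing$ the identity. For $0\le k\le n$, $\nabla^k f:=(D_Jf)_{|J|=k}$; $f^{\ge k}$ is the component of $f$ orthogonal in $L^2$ to the null space of $\nabla^k$, and $W^{\ge k}(f):=\|f^{\ge k}\|_{L^2}^2$; equivalently $W^{\ge k}(f)=\sum_{|S|\ge k}\widehat f(S)^2$ with $\widehat f(S)=\mathbb E[f\chi_S]$, $\chi_S(x)=\prod_{i\in S}x_i$. Conventions: the right-hand side is $0$ if $W^{\ge k}(f)=0$;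 for $k=0$ the bracket raised to the power $0$ equals $1$. *)

theory Defs
  imports "HOL-Analysis.Analysis"
begin

text \<open>
  A real function on the cube \<open>{-1,1}\<^sup>n\<close> is represented by a function
  \<open>f :: (nat \<Rightarrow> real) \<Rightarrow> real\<close> of which only the values on \<^term>\<open>cube n\<close> matter.
\<close>

definition cube :: "nat \<Rightarrow> (nat \<Rightarrow> real) set" where
  "cube n = {1..n} \<rightarrow>\<^sub>E {-1, 1}"

definition cube_measure :: "nat \<Rightarrow> (nat \<Rightarrow> real) measure" where
  "cube_measure n = uniform_count_measure (cube n)"

definition Lp_norm :: "nat \<Rightarrow> real \<Rightarrow> ((nat \<Rightarrow> real) \<Rightarrow> real) \<Rightarrow> real" where
  "Lp_norm n p f = (\<integral>x. \<bar>f x\<bar> powr p \<partial>cube_measure n) powr (1 / p)"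

definition L2_inner :: "nat \<Rightarrow> ((nat \<Rightarrow> real) \<Rightarrow> real) \<Rightarrow> ((nat \<Rightarrow> real) \<Rightarrow> real) \<Rightarrow> real" where
  "L2_inner n f g = (\<integral>x. f x * g x \<partial>cube_measure n)"

definition D :: "nat \<Rightarrow> ((nat \<Rightarrow> real) \<Rightarrow> real) \<Rightarrow> ((nat \<Rightarrow> real) \<Rightarrow> real)" where
  "D i f = (\<lambda>x. (f (x(i := 1)) - f (x(i := -1))) / 2)"

text \<open>The operators \<^term>\<open>D i\<close> commute, so their product over a finite set can be taken
  by \<^const>\<open>Finite_Set.fold\<close>, in any order.\<close>

lemma comp_fun_commute_D: "comp_fun_commute D"
proof
  fix i j :: nat
  have "D i (D j f) = D j (D i f)" for f
    by (cases "i = j") (auto simp: D_def fun_upd_twist[of i j] fun_eq_iff field_simps)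
  then show "D j \<circ> D i = D i \<circ> D j"
    by (auto simp: fun_eq_iff)
qed

definition D_set :: "nat set \<Rightarrow> ((nat \<Rightarrow> real) \<Rightarrow> real) \<Rightarrow> ((nat \<Rightarrow> real) \<Rightarrow> real)" where
  "D_set J f = Finite_Set.fold D f J"

lemma D_set_empty: "D_set {} f = f"
  by (simp add: D_set_def)

lemma D_set_insert:
  assumes "finite J" "i \<notin> J"
  shows "D_set (insert i J) f = D i (D_set J f)"
proof -
  interpret comp_fun_commute D by (rule comp_fun_commute_D)
  show ?thesis using assms by (simp add: D_set_def)
qed

text \<open>The null space of \<open>\<nabla>\<^sup>k f = (D\<^sub>J f)\<close>, \<open>J\<close> ranging over the \<open>k\<close>-subsets of
  \<open>{1..n}\<close>, as an operator on functions on the cube.\<close>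

definition null_nabla :: "nat \<Rightarrow> nat \<Rightarrow> ((nat \<Rightarrow> real) \<Rightarrow> real) set" where
  "null_nabla n k = {h. \<forall>J. J \<subseteq> {1..n} \<and> card J = k \<longrightarrow> (\<forall>x\<in>cube n. D_set J h x = 0)}"

text \<open>The component of \<open>f\<close> orthogonal to the null space, i.e. the \<open>g\<close> in the orthogonal
  decomposition \<open>f = (f - g) + g\<close>. Since \<^const>\<open>L2_inner\<close> is definite only on the cube,
  the condition \<^term>\<open>g \<in> extensional (cube n)\<close> is what makes \<open>g\<close> unique.\<close>

definition f_ge :: "nat \<Rightarrow> nat \<Rightarrow> ((nat \<Rightarrow> real) \<Rightarrow> real) \<Rightarrow> ((nat \<Rightarrow> real) \<Rightarrow> real)" where
  "f_ge n k f = (THE g. g \<in> extensional (cube n) \<and>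
      (\<lambda>x. f x - g x) \<in> null_nabla n k \<and> (\<forall>h\<in>null_nabla n k. L2_inner n g h = 0))"

definition W_ge :: "nat \<Rightarrow> nat \<Rightarrow> ((nat \<Rightarrow> real) \<Rightarrow> real) \<Rightarrow> real" where
  "W_ge n k f = (Lp_norm n 2 (f_ge n k f))\<^sup>2"

definition C :: "real \<Rightarrow> real" where
  "C p = inverse (1 + 1 / (exp 1 * (2 - p)))"

end

theory Submission
  imports Defs
begin

text \<open>
  The idea is to express \<open>W = W\<^bsup>\<ge>k\<^esup>(f)\<close> exactly through the noise operator \<open>T\<^sub>\<rho>\<close> applied to the
  derivatives \<open>D\<^sub>J f\<close>, and then to gain from hypercontractivity. In the Walsh basis
  \<open>W\<close> is the sum of the squares of the coefficients of degree at least \<open>k\<close> (\<open>W_ge_eq\<close>), while the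
  sum over \<open>J\<close> of \<open>\<parallel>T\<^sub>\<rho> D\<^sub>J f\<parallel>\<^sub>2\<^sup>2\<close> gives a set \<open>S\<close> the weight
  \<open>(card S choose k)\<close> times a power of \<open>\<rho>\<close>. A Beta integral in \<open>\<rho> = 1 - t\<close> cancels the binomial coefficient
  and gives, for \<open>k \<ge> 1\<close> (\<open>W_ge_integral\<close>),
  \<open>W = \<integral>\<^sub>0\<^sup>1 k (2 t - t\<^sup>2)\<^bsup>k-1\<^esup> 2 (1 - t) \<Sum>\<^sub>J \<parallel>T\<^sub>\<rho> D\<^sub>J f\<parallel>\<^sub>2\<^sup>2 dt\<close>.

  Let \<open>M\<close> be the maximum of the \<open>\<parallel>D\<^sub>J f\<parallel>\<^sub>p\<^sup>p\<close> and \<open>q = 2 / p - 1\<close>. As \<open>\<bar>D\<^sub>J f\<bar> \<le> 1\<close>, the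
  Bonami--Beckner inequality (\<open>hypercontractivity\<close>) bounds each energy by \<open>M\<close> to the power
  \<open>1 + min t q\<close> (\<open>noise_energy_le_powr\<close>). Put \<open>N = n choose k\<close> and \<open>L = - ln M / k\<close>. Then \<open>W / N\<close> is at
  most \<open>M\<close> times the integral of \<open>k (2 t - t\<^sup>2)\<^bsup>k-1\<^esup> 2 (1 - t) v(t)\<^sup>k\<close>, where \<open>v(t)\<close> is
  the exponential of \<open>- L min t q\<close>. Because \<open>v\<close> decreases, this integral is at most \<open>u\<^sup>k\<close> with
  \<open>u = \<integral>\<^sub>0\<^sup>1 2 (1 - t) v(t) dt\<close> (\<open>weighted_power_integral_le\<close>), so that the problem is one about a
  single elementary integral, independently of \<open>k\<close>.

  That integral satisfies \<open>u (2 + L) \<le> 2 + 1 / (e q)\<close> (\<open>truncated_exp_integral_bound\<close>), ultimately because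
  \<open>x e\<^bsup>-x\<^esup> \<le> 1 / e\<close>. Since \<open>y (1 - (ln y) / 2)\<close> increases on \<open>(0, 1]\<close>, it may be
  evaluated at the upper bound \<open>M\<^bsup>1/k\<^esup> u\<close> of \<open>(W / N)\<^bsup>1/k\<^esup>\<close>, which gives at most
  \<open>M\<^bsup>1/k\<^esup>\<close> times \<open>1 + 1 / (2 e q) + 1 / (2 e) = 1 / C(p)\<close>. The \<open>k\<close>-th power of this is the claim
  (\<open>solve_for_maximum\<close>).
\<close>

section \<open>Two-point and Minkowski inequalities\<close>

lemma powr_sum_ge_two:
  fixes b c :: real
  assumes "0 \<le> b" "b < 1" "c \<le> 0"
  shows "2 \<le> (1 + b) powr c + (1 - b) powr c"
proof -
  have "1 \<le> ((1 + b) * (1 - b)) powr c"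
  proof -
    have "1 powr c \<le> ((1 + b) * (1 - b)) powr c"
      using assms mult_strict_mono[of b 1 b 1] by (intro powr_mono2') (auto simp: algebra_simps)
    then show ?thesis by simp
  qed
  also have "\<dots> = (1 + b) powr c * (1 - b) powr c"
    using assms by (simp add: powr_mult)
  finally have 1: "1 \<le> (1 + b) powr c * (1 - b) powr c" .
  have "2 \<le> x + y" if "x > 0" "y > 0" "1 \<le> x * y" for x y :: real
  proof -
    have "4 \<le> (x + y)\<^sup>2"
      using that sum_squares_ge_zero[of "x - y" 0] by (simp add: power2_eq_square algebra_simps)
    then have "2\<^sup>2 \<le> (x + y)\<^sup>2" by simp
    then show ?thesis using that by (intro power2_le_imp_le[of 2]) auto
  qed
  then show ?thesis using 1 assms by simp
qed

text \<open>
  Both sides agree to first order at \<open>b = 0\<close>, and the second derivative of the difference is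
  \<open>p (p - 1)\<close> times the quantity that \<open>powr_sum_ge_two\<close> shows to be nonnegative.
\<close>

lemma two_point_quadratic:
  fixes b p :: real
  assumes b: "0 \<le> b" "b \<le> 1" and p: "1 \<le> p" "p \<le> 2"
  shows "2 + p * (p - 1) * b\<^sup>2 \<le> (1 + b) powr p + (1 - b) powr p"
proof -
  define g where "g = (\<lambda>b. (1 + b) powr (p - 1) - (1 - b) powr (p - 1) - 2 * (p - 1) * b)"
  define f where "f = (\<lambda>b. (1 + b) powr p + (1 - b) powr p - p * (p - 1) * b\<^sup>2)"
  have g: "0 \<le> g b" if "0 \<le> b" "b < 1" for b
  proof -
    have "g 0 \<le> g b"
    proof (rule DERIV_nonneg_imp_nondecreasing[OF that(1)])
      fix x assume x: "0 \<le> x" "x \<le> b"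
      have "(g has_real_derivative (p - 1) * ((1 + x) powr (p - 2) + (1 - x) powr (p - 2) - 2)) (at x)"
        unfolding g_def using x that
        by (auto intro!: derivative_eq_intros simp: algebra_simps)
      moreover have "0 \<le> (p - 1) * ((1 + x) powr (p - 2) + (1 - x) powr (p - 2) - 2)"
        using powr_sum_ge_two[of x "p - 2"] x that p by auto
      ultimately show "\<exists>y. (g has_real_derivative y) (at x) \<and> 0 \<le> y" by blast
    qed
    then show ?thesis by (simp add: g_def)
  qed
  have "f 0 \<le> f b"
  proof (rule DERIV_nonneg_imp_increasing_open[OF b(1)])
    fix x assume x: "0 < x" "x < b"
    have "(f has_real_derivative p * g x) (at x)"
      unfolding f_def g_def using x b
      by (auto intro!: derivative_eq_intros simp: algebra_simps)
    then show "\<exists>y. (f has_real_derivative y) (at x) \<and> 0 \<le> y"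
      using g[of x] x b p by (intro exI[of _ "p * g x"]) auto
  next
    show "continuous_on {0..b} f"
      unfolding f_def using p b by (intro continuous_intros continuous_on_powr') auto
  qed
  then show ?thesis by (simp add: f_def)
qed

lemma powr_le_linear:
  fixes y a :: real
  assumes "0 \<le> y" "0 \<le> a" "a \<le> 1"
  shows "(1 + y) powr a \<le> 1 + a * y"
  using Youngs_inequality_0[of a "1 - a" "1 + y" 1] assms by (simp add: algebra_simps)

text \<open>
  After scaling to \<open>a = 1\<close>, both sides are separated by \<open>1 + p (p - 1) t\<^sup>2 / 2\<close>: Bernoulli's inequality
  with exponent \<open>p / 2 \<le> 1\<close> on the left, the quadratic lower bound on the right.
\<close>

lemma two_point_ordered:
  fixes a b p :: real
  assumes ab: "0 \<le> b" "b \<le> a" and p: "1 \<le> p" "p \<le> 2"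
  shows "(a\<^sup>2 + (p - 1) * b\<^sup>2) powr (p / 2) \<le> ((a + b) powr p + (a - b) powr p) / 2"
proof (cases "a = 0")
  case False
  define t where "t = b / a"
  have a: "a > 0" and t: "0 \<le> t" "t \<le> 1" "b = a * t" using False ab by (auto simp: t_def)
  have "(1 + (p - 1) * t\<^sup>2) powr (p / 2) \<le> 1 + (p / 2) * ((p - 1) * t\<^sup>2)"
    using p by (intro powr_le_linear) auto
  also have "\<dots> \<le> ((1 + t) powr p + (1 - t) powr p) / 2"
    using two_point_quadratic[OF t(1,2) p] by (simp add: field_simps)
  finally have *: "(1 + (p - 1) * t\<^sup>2) powr (p / 2) \<le> ((1 + t) powr p + (1 - t) powr p) / 2" .
  have "a\<^sup>2 + (p - 1) * b\<^sup>2 = a powr 2 * (1 + (p - 1) * t\<^sup>2)"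
    using a by (simp add: t powr_numeral power_mult_distrib algebra_simps)
  then have "(a\<^sup>2 + (p - 1) * b\<^sup>2) powr (p / 2) = a powr p * (1 + (p - 1) * t\<^sup>2) powr (p / 2)"
    using a p powr_powr[of a 2 "p / 2"] by (simp add: powr_mult)
  also have "\<dots> \<le> a powr p * (((1 + t) powr p + (1 - t) powr p) / 2)"
    using * by (intro mult_left_mono) auto
  also have "\<dots> = ((a * (1 + t)) powr p + (a * (1 - t)) powr p) / 2"
    by (simp only: powr_mult ring_distribs(1)[of "a powr p"] times_divide_eq_right)
  finally show ?thesis by (simp add: t algebra_simps)
qed (use ab p in auto)

text \<open>
  Bonami's two-point inequality. For \<open>\<bar>b\<bar> \<le> \<bar>a\<bar>\<close> this is the
  quadratic lower bound rescaled by \<open>\<bar>a\<bar>\<close>. Exchanging \<open>a\<close> and \<open>b\<close> leaves the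
  right-hand side alone and, as \<open>p - 1 \<le> 1\<close>, increases the left-hand side when
  \<open>\<bar>a\<bar> < \<bar>b\<bar>\<close>.
\<close>

lemma two_point_inequality:
  fixes a b p :: real
  assumes p: "1 \<le> p" "p \<le> 2"
  shows "(a\<^sup>2 + (p - 1) * b\<^sup>2) powr (p / 2) \<le> (\<bar>a + b\<bar> powr p + \<bar>a - b\<bar> powr p) / 2"
proof -
  have abs: "\<bar>a + b\<bar> powr p + \<bar>a - b\<bar> powr p
      = (\<bar>a\<bar> + \<bar>b\<bar>) powr p + \<bar>\<bar>a\<bar> - \<bar>b\<bar>\<bar> powr p"
  proof (cases "0 \<le> a \<longleftrightarrow> 0 \<le> b")
    case True
    then have "\<bar>a + b\<bar> = \<bar>a\<bar> + \<bar>b\<bar>" "\<bar>a - b\<bar> = \<bar>\<bar>a\<bar> - \<bar>b\<bar>\<bar>" by auto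
    then show ?thesis by simp
  next
    case False
    then have "\<bar>a - b\<bar> = \<bar>a\<bar> + \<bar>b\<bar>" "\<bar>a + b\<bar> = \<bar>\<bar>a\<bar> - \<bar>b\<bar>\<bar>" by auto
    then show ?thesis by simp
  qed
  show ?thesis
  proof (cases "\<bar>b\<bar> \<le> \<bar>a\<bar>")
    case True
    then show ?thesis
      using two_point_ordered[of "\<bar>b\<bar>" "\<bar>a\<bar>" p] p abs by simp
  next
    case False
    have "0 \<le> (2 - p) * (b\<^sup>2 - a\<^sup>2)"
      using False p by (intro mult_nonneg_nonneg) (auto simp: abs_le_square_iff[symmetric])
    then have "a\<^sup>2 + (p - 1) * b\<^sup>2 \<le> b\<^sup>2 + (p - 1) * a\<^sup>2"
      by (simp add: algebra_simps)
    then have "(a\<^sup>2 + (p - 1) * b\<^sup>2) powr (p / 2) \<le> (b\<^sup>2 + (p - 1) * a\<^sup>2) powr (p / 2)"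
      using p by (intro powr_mono2) auto
    also have "\<dots> \<le> ((\<bar>b\<bar> + \<bar>a\<bar>) powr p + (\<bar>b\<bar> - \<bar>a\<bar>) powr p) / 2"
      using two_point_ordered[of "\<bar>a\<bar>" "\<bar>b\<bar>" p] p False by simp
    also have "\<dots> = (\<bar>a + b\<bar> powr p + \<bar>a - b\<bar> powr p) / 2"
      using False abs by (simp add: add.commute abs_minus_commute)
    finally show ?thesis .
  qed
qed

text \<open>
  The endpoint \<open>0\<close> is included because Minkowski's inequality will be applied to vectors
  with zero entries; there convexity is the scaling bound \<open>c\<^sup>r \<le> c\<close> for \<open>0 < c < 1\<close>.
\<close>

lemma powr_convex_nonneg:
  fixes r :: real
  assumes r: "1 \<le> r"
  shows "convex_on {0..} (\<lambda>x. x powr r)"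
proof (rule convex_onI)
  fix t x y :: real
  assume t: "0 < t" "t < 1" and xy: "x \<in> {0..}" "y \<in> {0..}"
  have scale: "(c * z) powr r \<le> c * z powr r" if "0 < c" "c < 1" "0 \<le> z" for c z :: real
  proof -
    have "c powr r \<le> c powr 1" using that r by (intro powr_mono') auto
    then show ?thesis using that by (simp add: powr_mult mult_right_mono)
  qed
  consider "x = 0" | "y = 0" | "x > 0" "y > 0" using xy by fastforce
  then show "((1 - t) *\<^sub>R x + t *\<^sub>R y) powr r \<le> (1 - t) * x powr r + t * y powr r"
  proof cases
    case 3
    then show ?thesis
      using convex_onD[OF powr_convex[OF r], of t x y] t by simp
  qed (use scale[of t y] scale[of "1 - t" x] t xy in auto)
qed auto

text \<open>
  The triangle inequality in \<open>\<ell>\<^sup>r\<close> on the plane: after division by the sum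
  \<open>m + n\<close> of the norms, each coordinate of the sum is a convex combination, with the same weight
  \<open>l\<close>, of the coordinates of the two unit vectors.
\<close>

lemma minkowski_two:
  fixes a b c d r :: real
  assumes nn: "0 \<le> a" "0 \<le> b" "0 \<le> c" "0 \<le> d" and r: "1 \<le> r"
  shows "((a + c) powr r + (b + d) powr r) powr (1 / r)
    \<le> (a powr r + b powr r) powr (1 / r) + (c powr r + d powr r) powr (1 / r)"
proof -
  define m where "m = (a powr r + b powr r) powr (1 / r)"
  define n where "n = (c powr r + d powr r) powr (1 / r)"
  have m0: "m \<ge> 0" and n0: "n \<ge> 0" by (auto simp: m_def n_def)
  have mr: "m powr r = a powr r + b powr r" and nr: "n powr r = c powr r + d powr r"
    using r by (auto simp: m_def n_def powr_powr)
  show ?thesis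
  proof (cases "m = 0 \<or> n = 0")
    case True
    have "a = 0 \<and> b = 0" if "m = 0"
      using that mr r by (simp add: add_nonneg_eq_0_iff)
    moreover have "c = 0 \<and> d = 0" if "n = 0"
      using that nr r by (simp add: add_nonneg_eq_0_iff)
    ultimately show ?thesis using True r by auto
  next
    case False
    then have pos: "m > 0" "n > 0" using m0 n0 by auto
    define l where "l = m / (m + n)"
    have l: "0 \<le> l" "l \<le> 1" "1 - l = n / (m + n)" using pos by (auto simp: l_def field_simps)
    have conv: "((x + y) / (m + n)) powr r \<le> l * (x powr r / m powr r) + (1 - l) * (y powr r / n powr r)"
      if "0 \<le> x" "0 \<le> y" for x y :: real
    proof -
      have eq: "(x + y) / (m + n) = l * (x / m) + (1 - l) * (y / n)"
        using pos unfolding l(3) unfolding l_def by (simp add: add_divide_distrib)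
      have "((1 - l) *\<^sub>R (y / n) + l *\<^sub>R (x / m)) powr r
          \<le> (1 - l) * (y / n) powr r + l * (x / m) powr r"
        using l that pos r
        by (intro convex_onD[OF powr_convex_nonneg]) auto
      then show ?thesis using eq that pos by (simp add: powr_divide add.commute)
    qed
    have "((a + c) / (m + n)) powr r + ((b + d) / (m + n)) powr r
      \<le> l * ((a powr r + b powr r) / m powr r) + (1 - l) * ((c powr r + d powr r) / n powr r)"
      using conv[OF nn(1,3)] conv[OF nn(2,4)] by (simp add: algebra_simps add_divide_distrib)
    also have "\<dots> = 1" using pos by (simp add: mr[symmetric] nr[symmetric])
    finally have "((a + c) powr r + (b + d) powr r) / (m + n) powr r \<le> 1"
      using nn pos by (simp add: powr_divide add_divide_distrib[of "(a + c) powr r"])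
    then have "(a + c) powr r + (b + d) powr r \<le> (m + n) powr r"
      using pos by (simp add: field_simps)
    then have "((a + c) powr r + (b + d) powr r) powr (1 / r) \<le> ((m + n) powr r) powr (1 / r)"
      using r by (intro powr_mono2) auto
    also have "\<dots> = m + n" using pos r by (simp add: powr_powr)
    finally show ?thesis by (simp add: m_def n_def)
  qed
qed

lemma minkowski_sum:
  fixes a b :: "'a \<Rightarrow> real"
  assumes "finite X" "\<And>x. x \<in> X \<Longrightarrow> 0 \<le> a x" "\<And>x. x \<in> X \<Longrightarrow> 0 \<le> b x" and r: "1 \<le> r"
  shows "(sum a X powr r + sum b X powr r) powr (1 / r)
    \<le> (\<Sum>x\<in>X. (a x powr r + b x powr r) powr (1 / r))"
  using assms(1-3)
proof (induction X rule: finite_induct)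
  case (insert x X)
  have "((a x + sum a X) powr r + (b x + sum b X) powr r) powr (1 / r)
    \<le> (a x powr r + b x powr r) powr (1 / r) + (sum a X powr r + sum b X powr r) powr (1 / r)"
    using insert by (intro minkowski_two r sum_nonneg) auto
  also have "\<dots> \<le> (a x powr r + b x powr r) powr (1 / r) + (\<Sum>x\<in>X. (a x powr r + b x powr r) powr (1 / r))"
    using insert by auto
  finally show ?case using insert by simp
qed auto

section \<open>Walsh analysis on the cube\<close>

definition cube_avg :: "nat \<Rightarrow> ((nat \<Rightarrow> real) \<Rightarrow> real) \<Rightarrow> real" where
  "cube_avg n F = (\<Sum>x\<in>cube n. F x) / 2 ^ n"

definition walsh :: "nat set \<Rightarrow> (nat \<Rightarrow> real) \<Rightarrow> real" where
  "walsh S x = (\<Prod>i\<in>S. x i)"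

definition fourier :: "nat \<Rightarrow> ((nat \<Rightarrow> real) \<Rightarrow> real) \<Rightarrow> nat set \<Rightarrow> real" where
  "fourier n f S = cube_avg n (\<lambda>x. f x * walsh S x)"

text \<open>
  By Parseval this is \<open>\<parallel>T\<^sub>\<rho> f\<parallel>\<^sub>2\<^sup>2\<close> for the noise operator \<open>T\<^sub>\<rho>\<close>, which multiplies
  \<open>\<chi>\<^sub>S\<close> by \<open>\<rho>\<close> to the power \<open>card S\<close>.
\<close>

definition noise_energy :: "nat \<Rightarrow> real \<Rightarrow> ((nat \<Rightarrow> real) \<Rightarrow> real) \<Rightarrow> real" where
  "noise_energy n \<rho> f = (\<Sum>S\<in>Pow {1..n}. \<rho> ^ (2 * card S) * (fourier n f S)\<^sup>2)"

lemma finite_cube [simp]: "finite (cube n)"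
  unfolding cube_def by (intro finite_PiE) auto

lemma card_cube: "card (cube n) = 2 ^ n"
  unfolding cube_def by (simp add: card_PiE numeral_2_eq_2)

lemma cube_Suc_split:
  "(\<Sum>x\<in>cube (Suc n). F x) = (\<Sum>x\<in>cube n. F (x(Suc n := 1)) + F (x(Suc n := -1)))"
proof -
  have eq: "cube (Suc n) = (\<lambda>(y, g). g(Suc n := y)) ` ({-1, 1} \<times> cube n)"
    unfolding cube_def by (simp add: atLeastAtMostSuc_conv PiE_insert_eq)
  have inj: "inj_on (\<lambda>(y, g). g(Suc n := y)) ({-1, 1} \<times> cube n)"
    unfolding cube_def by (rule inj_combinator) auto
  have "(\<Sum>x\<in>cube (Suc n). F x) = (\<Sum>(y, g)\<in>{-1, 1} \<times> cube n. F (g(Suc n := y)))"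
    unfolding eq by (subst sum.reindex[OF inj]) (simp add: case_prod_unfold)
  also have "\<dots> = (\<Sum>y\<in>{-1, 1}. \<Sum>g\<in>cube n. F (g(Suc n := y)))"
    by (simp add: sum.cartesian_product)
  also have "\<dots> = (\<Sum>x\<in>cube n. F (x(Suc n := 1)) + F (x(Suc n := -1)))"
    by (simp add: sum.distrib add.commute)
  finally show ?thesis .
qed

lemma cube_avg_0: "cube_avg 0 F = F (\<lambda>_. undefined)"
  by (simp add: cube_avg_def cube_def)

lemma cube_avg_Suc:
  "cube_avg (Suc n) F = cube_avg n (\<lambda>x. (F (x(Suc n := 1)) + F (x(Suc n := -1))) / 2)"
  by (simp add: cube_avg_def cube_Suc_split sum_divide_distrib)

lemma cube_avg_cong: "(\<And>x. x \<in> cube n \<Longrightarrow> F x = G x) \<Longrightarrow> cube_avg n F = cube_avg n G"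
  by (simp add: cube_avg_def)

lemma cube_avg_mono: "(\<And>x. x \<in> cube n \<Longrightarrow> F x \<le> G x) \<Longrightarrow> cube_avg n F \<le> cube_avg n G"
  by (simp add: cube_avg_def divide_right_mono sum_mono)

lemma cube_avg_nonneg: "(\<And>x. x \<in> cube n \<Longrightarrow> 0 \<le> F x) \<Longrightarrow> 0 \<le> cube_avg n F"
  by (simp add: cube_avg_def sum_nonneg)

lemma cube_avg_const [simp]: "cube_avg n (\<lambda>_. c) = c"
  by (simp add: cube_avg_def card_cube)

lemma cube_avg_add: "cube_avg n (\<lambda>x. F x + G x) = cube_avg n F + cube_avg n G"
  by (simp add: cube_avg_def sum.distrib add_divide_distrib)

lemma cube_avg_diff: "cube_avg n (\<lambda>x. F x - G x) = cube_avg n F - cube_avg n G"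
  by (simp add: cube_avg_def sum_subtractf diff_divide_distrib)

lemma cube_avg_cmult: "cube_avg n (\<lambda>x. c * F x) = c * cube_avg n F"
  by (simp add: cube_avg_def sum_distrib_left)

lemma cube_avg_sum: "cube_avg n (\<lambda>x. \<Sum>i\<in>I. F i x) = (\<Sum>i\<in>I. cube_avg n (F i))"
  by (simp add: cube_avg_def sum.swap[of _ "cube n"] sum_divide_distrib)

lemma cube_avg_eq_0D:
  assumes "cube_avg n F = 0" "\<And>x. x \<in> cube n \<Longrightarrow> 0 \<le> F x" "x \<in> cube n"
  shows "F x = 0"
  using assms by (simp add: cube_avg_def sum_nonneg_eq_0_iff)

lemma integral_cube_measure: "(\<integral>x. F x \<partial>cube_measure n) = cube_avg n F"
  by (simp add: cube_measure_def integral_uniform_count_measure cube_avg_def card_cube)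

lemma Lp_norm_powr: "1 \<le> p \<Longrightarrow> Lp_norm n p F powr p = cube_avg n (\<lambda>x. \<bar>F x\<bar> powr p)"
  by (simp add: Lp_norm_def integral_cube_measure powr_powr cube_avg_nonneg)

lemma walsh_upd_notin: "i \<notin> S \<Longrightarrow> walsh S (x(i := c)) = walsh S x"
  unfolding walsh_def by (intro prod.cong) auto

lemma walsh_insert: "finite S \<Longrightarrow> i \<notin> S \<Longrightarrow> walsh (insert i S) x = x i * walsh S x"
  by (simp add: walsh_def)

lemma fourier_Suc_notin:
  assumes "S \<subseteq> {1..n}"
  shows "fourier (Suc n) f S = fourier n (\<lambda>x. (f (x(Suc n := 1)) + f (x(Suc n := -1))) / 2) S"
proof -
  have "Suc n \<notin> S" using assms by auto
  then show ?thesis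
    by (simp add: fourier_def cube_avg_Suc walsh_upd_notin algebra_simps add_divide_distrib)
qed

lemma fourier_Suc_insert:
  assumes "S \<subseteq> {1..n}"
  shows "fourier (Suc n) f (insert (Suc n) S) = fourier n (D (Suc n) f) S"
proof -
  have "Suc n \<notin> S" "finite S" using assms finite_subset by auto
  then show ?thesis
    by (simp add: fourier_def cube_avg_Suc walsh_insert walsh_upd_notin D_def algebra_simps diff_divide_distrib)
qed

text \<open>
  A function on \<open>n + 1\<close> bits is the sum of its mean over the last bit and of the last bit
  times its derivative in that bit; the Walsh coefficients split accordingly. This recursion drives
  both Parseval's identity and hypercontractivity.
\<close>

lemma noise_energy_Suc:
  "noise_energy (Suc n) \<rho> f =
    noise_energy n \<rho> (\<lambda>x. (f (x(Suc n := 1)) + f (x(Suc n := -1))) / 2)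
    + \<rho>\<^sup>2 * noise_energy n \<rho> (D (Suc n) f)"
proof -
  have Pow: "Pow {1..Suc n} = Pow {1..n} \<union> insert (Suc n) ` Pow {1..n}"
    by (simp add: atLeastAtMostSuc_conv Pow_insert)
  have disj: "Pow {1..n} \<inter> insert (Suc n) ` Pow {1..n} = {}" by auto
  have inj: "inj_on (insert (Suc n)) (Pow {1..n})"
    by (intro inj_onI) (force dest: insert_ident[THEN iffD1, rotated 2])
  have "(\<Sum>S\<in>insert (Suc n) ` Pow {1..n}. \<rho> ^ (2 * card S) * (fourier (Suc n) f S)\<^sup>2)
    = (\<Sum>S\<in>Pow {1..n}. \<rho> ^ (2 * card (insert (Suc n) S)) * (fourier (Suc n) f (insert (Suc n) S))\<^sup>2)"
    by (subst sum.reindex[OF inj]) simp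
  also have "\<dots> = (\<Sum>S\<in>Pow {1..n}. \<rho>\<^sup>2 * (\<rho> ^ (2 * card S) * (fourier n (D (Suc n) f) S)\<^sup>2))"
  proof (intro sum.cong refl)
    fix S assume S: "S \<in> Pow {1..n}"
    then have "Suc n \<notin> S" "finite S" using finite_subset by auto
    then show "\<rho> ^ (2 * card (insert (Suc n) S)) * (fourier (Suc n) f (insert (Suc n) S))\<^sup>2
      = \<rho>\<^sup>2 * (\<rho> ^ (2 * card S) * (fourier n (D (Suc n) f) S)\<^sup>2)"
      using S by (simp add: fourier_Suc_insert power2_eq_square)
  qed
  finally have 2: "(\<Sum>S\<in>insert (Suc n) ` Pow {1..n}. \<rho> ^ (2 * card S) * (fourier (Suc n) f S)\<^sup>2)
     = \<rho>\<^sup>2 * noise_energy n \<rho> (D (Suc n) f)"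
    by (simp add: noise_energy_def sum_distrib_left)
  show ?thesis
    unfolding noise_energy_def[of "Suc n"] Pow
    by (subst sum.union_disjoint) (use disj 2 in \<open>simp_all add: noise_energy_def fourier_Suc_notin\<close>)
qed

lemma noise_energy_0: "noise_energy 0 \<rho> f = (f (\<lambda>_. undefined))\<^sup>2"
  by (simp add: noise_energy_def fourier_def cube_avg_0 walsh_def)

lemma parseval: "noise_energy n 1 f = cube_avg n (\<lambda>x. (f x)\<^sup>2)"
proof (induction n arbitrary: f)
  case 0
  then show ?case by (simp add: noise_energy_0 cube_avg_0)
next
  case (Suc n)
  show ?case
    unfolding noise_energy_Suc Suc.IH cube_avg_Suc D_def
    by (simp flip: cube_avg_add, intro cube_avg_cong) (simp add: power2_eq_square field_simps)
qed

lemma noise_energy_mono: "0 \<le> \<rho> \<Longrightarrow> \<rho> \<le> \<sigma> \<Longrightarrow> noise_energy n \<rho> f \<le> noise_energy n \<sigma> f"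
  unfolding noise_energy_def by (intro sum_mono mult_right_mono power_mono) auto

section \<open>Hypercontractivity\<close>

text \<open>
  Since \<open>r = 2 / p \<ge> 1\<close>, this exchanges an \<open>\<ell>\<^sup>r\<close> sum over a bit with an average over the
  other coordinates. It is what lets the two-point inequality tensorise.
\<close>

lemma minkowski_avg:
  assumes "\<And>x. 0 \<le> a x" "\<And>x. 0 \<le> b x" and r: "1 \<le> r"
  shows "cube_avg n a powr r + cube_avg n b powr r
    \<le> cube_avg n (\<lambda>x. (a x powr r + b x powr r) powr (1 / r)) powr r"
proof -
  have "((cube_avg n a powr r + cube_avg n b powr r) powr (1 / r))
     = (sum a (cube n) powr r + sum b (cube n) powr r) powr (1 / r) / 2 ^ n"
    using r assms
    by (simp add: cube_avg_def powr_divide sum_nonneg powr_powr flip: add_divide_distrib)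
  also have "\<dots> \<le> cube_avg n (\<lambda>x. (a x powr r + b x powr r) powr (1 / r))"
    unfolding cube_avg_def using assms by (intro divide_right_mono minkowski_sum) auto
  finally have "((cube_avg n a powr r + cube_avg n b powr r) powr (1 / r)) powr r
    \<le> cube_avg n (\<lambda>x. (a x powr r + b x powr r) powr (1 / r)) powr r"
    using r by (intro powr_mono2) auto
  then show ?thesis using r by (simp add: powr_powr)
qed

text \<open>
  The Bonami--Beckner inequality \<open>\<parallel>T\<^sub>\<rho> f\<parallel>\<^sub>2 \<le> \<parallel>f\<parallel>\<^sub>p\<close> with \<open>p = 1 + \<rho>\<^sup>2\<close>. One more bit is
  added by applying the induction hypothesis to the mean \<open>f\<^sub>0\<close> and the derivative \<open>f\<^sub>1\<close> in that
  bit, then Minkowski's inequality, then the two-point inequality at each point.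
\<close>

theorem hypercontractivity:
  assumes \<rho>: "0 \<le> \<rho>" "\<rho> \<le> 1"
  shows "noise_energy n \<rho> f \<le> cube_avg n (\<lambda>x. \<bar>f x\<bar> powr (1 + \<rho>\<^sup>2)) powr (2 / (1 + \<rho>\<^sup>2))"
proof (induction n arbitrary: f)
  case 0
  have "1 + \<rho>\<^sup>2 \<noteq> 0" using zero_le_power2[of \<rho>] by linarith
  then show ?case by (simp add: noise_energy_0 cube_avg_0 powr_powr powr_numeral del: distrib_right_numeral distrib_left_numeral)
next
  case (Suc n)
  define p where "p = 1 + \<rho>\<^sup>2"
  have p: "1 \<le> p" "p \<le> 2" "\<rho>\<^sup>2 = p - 1" using \<rho> by (auto simp: p_def power_le_one)
  define f0 where "f0 = (\<lambda>x. (f (x(Suc n := 1)) + f (x(Suc n := -1))) / 2)"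
  define f1 where "f1 = D (Suc n) f"
  have \<rho>p: "(\<rho> powr p) powr (2 / p) = \<rho>\<^sup>2"
    using \<rho> p by (simp add: powr_powr powr_numeral)
  have sq: "(\<bar>y\<bar> powr p) powr (2 / p) = y\<^sup>2" for y
    using p by (simp add: powr_powr powr_numeral)
  have "noise_energy (Suc n) \<rho> f = noise_energy n \<rho> f0 + \<rho>\<^sup>2 * noise_energy n \<rho> f1"
    by (simp add: noise_energy_Suc f0_def f1_def)
  also have "\<dots> \<le> cube_avg n (\<lambda>x. \<bar>f0 x\<bar> powr p) powr (2 / p)
      + \<rho>\<^sup>2 * cube_avg n (\<lambda>x. \<bar>f1 x\<bar> powr p) powr (2 / p)"
    using Suc.IH[of f0] Suc.IH[of f1] unfolding p_def by (intro add_mono mult_left_mono) auto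
  also have "\<dots> = cube_avg n (\<lambda>x. \<bar>f0 x\<bar> powr p) powr (2 / p)
      + cube_avg n (\<lambda>x. \<bar>\<rho> * f1 x\<bar> powr p) powr (2 / p)"
    using \<rho> p by (simp add: abs_mult powr_mult cube_avg_cmult cube_avg_nonneg \<rho>p)
  also have "\<dots> \<le> cube_avg n (\<lambda>x. ((\<bar>f0 x\<bar> powr p) powr (2 / p)
      + (\<bar>\<rho> * f1 x\<bar> powr p) powr (2 / p)) powr (1 / (2 / p))) powr (2 / p)"
    using p by (intro minkowski_avg) auto
  also have "\<dots> = cube_avg n (\<lambda>x. ((f0 x)\<^sup>2 + (p - 1) * (f1 x)\<^sup>2) powr (p / 2)) powr (2 / p)"
    by (simp add: sq power_mult_distrib p)
  also have "\<dots> \<le> cube_avg n (\<lambda>x. (\<bar>f0 x + f1 x\<bar> powr p + \<bar>f0 x - f1 x\<bar> powr p) / 2) powr (2 / p)"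
    using p by (intro powr_mono2 cube_avg_mono cube_avg_nonneg two_point_inequality) auto
  also have "\<dots> = cube_avg (Suc n) (\<lambda>x. \<bar>f x\<bar> powr p) powr (2 / p)"
    unfolding cube_avg_Suc f0_def f1_def D_def by (simp flip: add_divide_distrib diff_divide_distrib)
  finally show ?case by (simp add: p_def)
qed

section \<open>Discrete derivatives and the weight of high degree\<close>

lemma cube_upd: "x \<in> cube n \<Longrightarrow> i \<in> {1..n} \<Longrightarrow> c \<in> {-1, 1} \<Longrightarrow> x(i := c) \<in> cube n"
  unfolding cube_def by (auto simp: PiE_iff extensional_def)

lemma cube_coord: "x \<in> cube n \<Longrightarrow> i \<in> {1..n} \<Longrightarrow> x i = 1 \<or> x i = -1"
  unfolding cube_def by (auto simp: PiE_iff)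

text \<open>
  The flip of coordinate \<open>i\<close> preserves the uniform measure, so coordinate \<open>i\<close> may be
  replaced by a fresh random sign.
\<close>

lemma cube_avg_resample:
  assumes i: "i \<in> {1..n}"
  shows "cube_avg n F = cube_avg n (\<lambda>x. (F (x(i := 1)) + F (x(i := -1))) / 2)"
proof -
  define flip where "flip = (\<lambda>x :: nat \<Rightarrow> real. x(i := - x i))"
  have flip_in: "flip x \<in> cube n" if "x \<in> cube n" for x
    unfolding flip_def using cube_upd[OF that i, of "- x i"] cube_coord[OF that i] by auto
  have flip_flip: "flip (flip x) = x" for x by (simp add: flip_def)
  have "(\<Sum>x\<in>cube n. F x) = (\<Sum>x\<in>cube n. F (flip x))"
    by (rule sum.reindex_bij_witness[of _ flip flip]) (auto simp: flip_in flip_flip)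
  then have "2 * (\<Sum>x\<in>cube n. F x) = (\<Sum>x\<in>cube n. F x + F (flip x))"
    by (simp add: sum.distrib)
  also have "\<dots> = (\<Sum>x\<in>cube n. F (x(i := 1)) + F (x(i := -1)))"
  proof (intro sum.cong refl)
    fix x assume "x \<in> cube n"
    then consider "x i = 1" | "x i = -1" using cube_coord i by blast
    then show "F x + F (flip x) = F (x(i := 1)) + F (x(i := -1))"
    proof cases
      case 1
      then have "x(i := 1) = x" by (metis fun_upd_triv)
      then show ?thesis using 1 by (simp add: flip_def)
    next
      case 2
      then have "x(i := -1) = x" by (metis fun_upd_triv)
      then show ?thesis using 2 by (simp add: flip_def)
    qed
  qed
  finally show ?thesis
    by (simp add: cube_avg_def sum_divide_distrib[symmetric] field_simps)
qed

text \<open>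
  The operator \<^term>\<open>D i\<close> sends \<open>\<chi>\<^sub>S\<close> to \<open>\<chi>\<close> of \<open>S - {i}\<close> if \<open>i \<in> S\<close> and to \<open>0\<close> otherwise;
  this is the dual statement on coefficients.
\<close>

lemma fourier_D:
  assumes i: "i \<in> {1..n}" and S: "S \<subseteq> {1..n}"
  shows "fourier n (D i f) S = (if i \<in> S then 0 else fourier n f (insert i S))"
proof -
  have fin: "finite S" using S finite_subset by auto
  show ?thesis
  proof (cases "i \<in> S")
    case True
    define S' where "S' = S - {i}"
    have S': "S = insert i S'" "i \<notin> S'" "finite S'" using True fin by (auto simp: S'_def)
    show ?thesis
      unfolding fourier_def by (subst cube_avg_resample[OF i])
        (use S' in \<open>simp add: D_def walsh_insert walsh_upd_notin\<close>)
  next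
    case False
    show ?thesis
      unfolding fourier_def
      by (subst (2) cube_avg_resample[OF i])
        (use False fin in \<open>simp add: D_def walsh_insert walsh_upd_notin diff_divide_distrib algebra_simps\<close>)
  qed
qed

lemma fourier_D_set:
  assumes "J \<subseteq> {1..n}" "S \<subseteq> {1..n}"
  shows "fourier n (D_set J f) S = (if J \<inter> S = {} then fourier n f (J \<union> S) else 0)"
proof -
  have "finite J" using assms(1) finite_subset by auto
  then show ?thesis using assms
  proof (induction J arbitrary: S rule: finite_induct)
    case empty
    then show ?case by (simp add: D_set_empty)
  next
    case (insert i J)
    have "fourier n (D_set (insert i J) f) S = (if i \<in> S then 0 else fourier n (D_set J f) (insert i S))"
      using insert by (simp add: D_set_insert fourier_D)
    then show ?case using insert by auto
  qed
qed

lemma fourier_walsh: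
  assumes "S \<subseteq> {1..n}" "T \<subseteq> {1..n}"
  shows "fourier n (walsh S) T = (if S = T then 1 else 0)"
proof (cases "S = T")
  case True
  have "walsh S x * walsh S x = 1" if "x \<in> cube n" for x
    unfolding walsh_def prod.distrib[symmetric] using cube_coord[OF that] assms(1)
    by (intro prod.neutral) fastforce
  then have "fourier n (walsh S) S = cube_avg n (\<lambda>_. 1)"
    unfolding fourier_def by (intro cube_avg_cong)
  then show ?thesis using True by simp
next
  case False
  have *: "cube_avg n (\<lambda>x. walsh A x * walsh B x) = 0"
    if "A \<subseteq> {1..n}" "B \<subseteq> {1..n}" "i \<in> A" "i \<notin> B" for A B i
  proof -
    have fin: "finite A" using that(1) finite_subset by auto
    have A: "A = insert i (A - {i})" using that by auto
    have i: "i \<in> {1..n}" using that by auto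
    have flip: "walsh A (x(i := c)) = c * walsh (A - {i}) x" for x c
      using fin by (subst (1) A) (simp add: walsh_insert walsh_upd_notin del: insert_Diff_single)
    show ?thesis
      by (subst cube_avg_resample[OF i]) (use that in \<open>simp add: flip walsh_upd_notin\<close>)
  qed
  obtain i where "i \<in> S \<and> i \<notin> T \<or> i \<in> T \<and> i \<notin> S" using False by auto
  then show ?thesis
    using *[of S T i] *[of T S i] assms False by (auto simp: fourier_def mult.commute)
qed

lemma fourier_diff: "fourier n (\<lambda>x. f x - g x) S = fourier n f S - fourier n g S"
  by (simp add: fourier_def left_diff_distrib cube_avg_diff)

lemma fourier_cong: "(\<And>x. x \<in> cube n \<Longrightarrow> f x = g x) \<Longrightarrow> fourier n f S = fourier n g S"
  unfolding fourier_def by (intro cube_avg_cong) simp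

lemma fourier_eq_0D:
  assumes "\<And>S. S \<subseteq> {1..n} \<Longrightarrow> fourier n h S = 0" "x \<in> cube n"
  shows "h x = 0"
proof -
  have "cube_avg n (\<lambda>x. (h x)\<^sup>2) = 0"
    unfolding parseval[symmetric] noise_energy_def using assms(1) by simp
  then show ?thesis using cube_avg_eq_0D[of n "\<lambda>x. (h x)\<^sup>2" x] assms(2) by simp
qed

text \<open>
  The coefficients of \<open>D\<^sub>J h\<close> are coefficients of \<open>h\<close> at supersets of \<open>J\<close>, and a set has a
  \<open>k\<close>-element subset exactly if its size is at least \<open>k\<close>.
\<close>

lemma null_nabla_iff:
  "h \<in> null_nabla n k \<longleftrightarrow> (\<forall>S\<subseteq>{1..n}. k \<le> card S \<longrightarrow> fourier n h S = 0)"
proof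
  assume h: "h \<in> null_nabla n k"
  show "\<forall>S\<subseteq>{1..n}. k \<le> card S \<longrightarrow> fourier n h S = 0"
  proof (intro allI impI)
    fix S assume S: "S \<subseteq> {1..n}" "k \<le> card S"
    obtain J where J: "J \<subseteq> S" "card J = k" using S(2) by (rule obtain_subset_with_card_n)
    have "fourier n h S = fourier n (D_set J h) (S - J)"
      using J S by (subst fourier_D_set) (auto simp: Un_absorb1)
    also have "\<dots> = fourier n (\<lambda>_. 0) (S - J)"
      using h J S unfolding null_nabla_def by (intro fourier_cong) auto
    finally show "fourier n h S = 0" by (simp add: fourier_def)
  qed
next
  assume h: "\<forall>S\<subseteq>{1..n}. k \<le> card S \<longrightarrow> fourier n h S = 0"
  show "h \<in> null_nabla n k"
    unfolding null_nabla_def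
  proof (intro CollectI allI impI ballI)
    fix J x assume J: "J \<subseteq> {1..n} \<and> card J = k" and x: "x \<in> cube n"
    show "D_set J h x = 0"
    proof (rule fourier_eq_0D[OF _ x])
      fix S assume S: "S \<subseteq> {1..n}"
      have fin: "finite (J \<union> S)" using J S finite_subset[of "J \<union> S" "{1..n}"] by auto
      have "k \<le> card (J \<union> S)" using J card_mono[OF fin, of J] by auto
      then show "fourier n (D_set J h) S = 0"
        using h J S by (simp add: fourier_D_set)
    qed
  qed
qed

lemma L2_inner_eq: "L2_inner n f g = cube_avg n (\<lambda>x. f x * g x)"
  by (simp add: L2_inner_def integral_cube_measure)

text \<open>
  In the Walsh basis the null space is spanned by the characters of degree below \<open>k\<close>, so the
  component of \<open>f\<close> orthogonal to it keeps exactly the coefficients of degree at least \<open>k\<close>. The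
  description operator in \<^const>\<open>f_ge\<close> requires uniqueness: the difference of two candidates
  lies in the null space and is orthogonal to it.
\<close>

lemma W_ge_eq: "W_ge n k f = (\<Sum>S | S \<subseteq> {1..n} \<and> k \<le> card S. (fourier n f S)\<^sup>2)"
proof -
  define T where "T = {S. S \<subseteq> {1..n} \<and> k \<le> card S}"
  have finT: "finite T" by (auto simp: T_def intro: finite_subset[of _ "Pow {1..n}"])
  define is_proj where "is_proj = (\<lambda>g. g \<in> extensional (cube n) \<and>
      (\<lambda>x. f x - g x) \<in> null_nabla n k \<and> (\<forall>h\<in>null_nabla n k. L2_inner n g h = 0))"
  define g where "g = restrict (\<lambda>x. \<Sum>S\<in>T. fourier n f S * walsh S x) (cube n)"
  have fg: "fourier n g S = (if S \<in> T then fourier n f S else 0)" if S: "S \<subseteq> {1..n}" for S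
  proof -
    have "fourier n g S = fourier n (\<lambda>x. \<Sum>S\<in>T. fourier n f S * walsh S x) S"
      unfolding g_def by (intro fourier_cong) simp
    also have "\<dots> = (\<Sum>R\<in>T. fourier n f R * fourier n (walsh R) S)"
      by (simp add: fourier_def sum_distrib_right cube_avg_sum cube_avg_cmult mult.assoc)
    also have "\<dots> = (\<Sum>R\<in>T. if R = S then fourier n f R else 0)"
      using S by (intro sum.cong) (auto simp: fourier_walsh T_def)
    finally show ?thesis using finT by simp
  qed
  have ortho: "L2_inner n g h = 0" if h: "h \<in> null_nabla n k" for h
  proof -
    have "L2_inner n g h = cube_avg n (\<lambda>x. \<Sum>S\<in>T. fourier n f S * (h x * walsh S x))"
      unfolding L2_inner_eq g_def
      by (intro cube_avg_cong) (simp add: sum_distrib_left sum_distrib_right ac_simps)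
    also have "\<dots> = (\<Sum>S\<in>T. fourier n f S * fourier n h S)"
      by (simp add: cube_avg_sum cube_avg_cmult fourier_def)
    also have "\<dots> = 0" using h by (intro sum.neutral) (auto simp: null_nabla_iff T_def)
    finally show ?thesis .
  qed
  have g: "is_proj g"
    unfolding is_proj_def using ortho fg by (auto simp: g_def[symmetric] null_nabla_iff fourier_diff T_def)
      (simp add: g_def)
  have unique: "g' = g" if g': "is_proj g'" for g'
  proof -
    define d where "d = (\<lambda>x. g' x - g x)"
    have "d \<in> null_nabla n k"
      using g g' unfolding is_proj_def null_nabla_iff d_def by (simp add: fourier_diff)
    then have "L2_inner n g' d = 0" "L2_inner n g d = 0"
      using g g' by (auto simp: is_proj_def)
    then have "cube_avg n (\<lambda>x. d x * d x) = 0"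
      unfolding L2_inner_eq by (simp add: d_def left_diff_distrib cube_avg_diff)
    then have "d x = 0" if "x \<in> cube n" for x
      using cube_avg_eq_0D[of n "\<lambda>x. d x * d x" x] that by simp
    then show ?thesis
      using g g' unfolding is_proj_def d_def by (intro extensionalityI[of _ "cube n"]) auto
  qed
  have "f_ge n k f = (THE g. is_proj g)" by (simp add: f_ge_def is_proj_def)
  also have "\<dots> = g" using g unique by (intro the_equality)
  finally have "W_ge n k f = Lp_norm n 2 g powr 2"
    by (simp add: W_ge_def powr_numeral Lp_norm_def)
  also have "\<dots> = cube_avg n (\<lambda>x. (g x)\<^sup>2)"
    by (subst Lp_norm_powr) (simp_all add: powr_numeral)
  also have "\<dots> = (\<Sum>S\<in>Pow {1..n}. if S \<in> T then (fourier n f S)\<^sup>2 else 0)"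
    unfolding parseval[symmetric] noise_energy_def by (intro sum.cong) (auto simp: fg)
  also have "\<dots> = (\<Sum>S\<in>T. (fourier n f S)\<^sup>2)"
    by (subst sum.inter_restrict[symmetric]) (auto simp: T_def intro!: sum.cong)
  finally show ?thesis by (simp add: T_def)
qed

lemma D_bounded:
  assumes "\<And>x. x \<in> cube n \<Longrightarrow> \<bar>h x\<bar> \<le> 1" "i \<in> {1..n}" "x \<in> cube n"
  shows "\<bar>D i h x\<bar> \<le> 1"
  using assms(1)[OF cube_upd[OF assms(3,2), of 1]] assms(1)[OF cube_upd[OF assms(3,2), of "-1"]]
  by (simp add: D_def)

lemma D_set_bounded:
  assumes "\<And>x. x \<in> cube n \<Longrightarrow> \<bar>f x\<bar> \<le> 1" "J \<subseteq> {1..n}" "x \<in> cube n"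
  shows "\<bar>D_set J f x\<bar> \<le> 1"
proof -
  have "finite J" using assms(2) finite_subset by auto
  then show ?thesis using assms(2,3)
    by (induction J arbitrary: x rule: finite_induct)
      (auto simp: D_set_empty D_set_insert assms(1) intro!: D_bounded)
qed

lemma noise_energy_D_set:
  assumes "J \<subseteq> {1..n}"
  shows "noise_energy n \<rho> (D_set J f)
    = (\<Sum>S | S \<subseteq> {1..n} \<and> J \<subseteq> S. \<rho> ^ (2 * (card S - card J)) * (fourier n f S)\<^sup>2)"
proof -
  have fin: "finite J" using assms finite_subset by auto
  have "noise_energy n \<rho> (D_set J f)
    = (\<Sum>S\<in>Pow {1..n}. if J \<inter> S = {} then \<rho> ^ (2 * card S) * (fourier n f (J \<union> S))\<^sup>2 else 0)"
    unfolding noise_energy_def using assms by (intro sum.cong) (auto simp: fourier_D_set)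
  also have "\<dots> = (\<Sum>S | S \<subseteq> {1..n} \<and> J \<inter> S = {}. \<rho> ^ (2 * card S) * (fourier n f (J \<union> S))\<^sup>2)"
    by (subst sum.inter_filter[symmetric]) (auto intro!: sum.cong)
  also have "\<dots> = (\<Sum>S | S \<subseteq> {1..n} \<and> J \<subseteq> S. \<rho> ^ (2 * (card S - card J)) * (fourier n f S)\<^sup>2)"
    by (rule sum.reindex_bij_witness[of _ "\<lambda>S. S - J" "\<lambda>S. J \<union> S"])
      (use assms fin in \<open>auto simp: card_Diff_subset Un_absorb1 finite_subset card_Un_disjoint\<close>)
  finally show ?thesis .
qed

text \<open>
  A set \<open>S\<close> contributes once for each of its \<open>k\<close>-subsets \<open>J\<close>, always with the weight
  \<open>\<rho>\<close> to the power \<open>2 (card S - k)\<close>.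
\<close>

lemma sum_noise_energy_D_set:
  "(\<Sum>J | J \<subseteq> {1..n} \<and> card J = k. noise_energy n \<rho> (D_set J f))
    = (\<Sum>S | S \<subseteq> {1..n} \<and> k \<le> card S. real (card S choose k) * \<rho> ^ (2 * (card S - k)) * (fourier n f S)\<^sup>2)"
proof -
  have fin: "finite {J. J \<subseteq> {1..n} \<and> P J}" for P
    by (rule finite_subset[of _ "Pow {1..n}"]) auto
  have "(\<Sum>J | J \<subseteq> {1..n} \<and> card J = k. noise_energy n \<rho> (D_set J f))
    = (\<Sum>J | J \<subseteq> {1..n} \<and> card J = k. \<Sum>S\<in>Pow {1..n}.
        if J \<subseteq> S then \<rho> ^ (2 * (card S - k)) * (fourier n f S)\<^sup>2 else 0)"
  proof (intro sum.cong refl)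
    fix J assume "J \<in> {J. J \<subseteq> {1..n} \<and> card J = k}"
    then show "noise_energy n \<rho> (D_set J f) = (\<Sum>S\<in>Pow {1..n}.
        if J \<subseteq> S then \<rho> ^ (2 * (card S - k)) * (fourier n f S)\<^sup>2 else 0)"
      by (subst sum.inter_filter[symmetric]) (auto simp: noise_energy_D_set intro!: sum.cong)
  qed
  also have "\<dots> = (\<Sum>S\<in>Pow {1..n}. \<Sum>J | J \<subseteq> {1..n} \<and> card J = k.
        if J \<subseteq> S then \<rho> ^ (2 * (card S - k)) * (fourier n f S)\<^sup>2 else 0)"
    by (rule sum.swap)
  also have "\<dots> = (\<Sum>S\<in>Pow {1..n}. real (card S choose k) * \<rho> ^ (2 * (card S - k)) * (fourier n f S)\<^sup>2)"
  proof (intro sum.cong refl)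
    fix S assume S: "S \<in> Pow {1..n}"
    have "finite S" using S finite_subset by auto
    moreover have "{J \<in> {J. J \<subseteq> {1..n} \<and> card J = k}. J \<subseteq> S} = {J. J \<subseteq> S \<and> card J = k}"
      using S by auto
    ultimately show "(\<Sum>J | J \<subseteq> {1..n} \<and> card J = k.
        if J \<subseteq> S then \<rho> ^ (2 * (card S - k)) * (fourier n f S)\<^sup>2 else 0)
      = real (card S choose k) * \<rho> ^ (2 * (card S - k)) * (fourier n f S)\<^sup>2"
      using fin by (subst sum.inter_filter[symmetric]) (auto simp: n_subsets)
  qed
  also have "\<dots> = (\<Sum>S | S \<subseteq> {1..n} \<and> k \<le> card S. real (card S choose k) * \<rho> ^ (2 * (card S - k)) * (fourier n f S)\<^sup>2)"
    by (rule sum.mono_neutral_right) (auto simp: not_le binomial_eq_0)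
  finally show ?thesis .
qed

section \<open>The weight of high degree as an integral over the noise\<close>

lemma has_derivative_parabola_power:
  "((\<lambda>t::real. (2 * t - t\<^sup>2) ^ Suc k) has_real_derivative
    real (Suc k) * (2 * t - t\<^sup>2) ^ k * (2 * (1 - t))) (at t within X)"
proof -
  have "((\<lambda>t::real. 2 * t - t\<^sup>2) has_real_derivative 2 * (1 - t)) (at t within X)"
    by (auto intro!: derivative_eq_intros)
  from DERIV_power[OF this, of "Suc k"] show ?thesis by (simp add: ac_simps)
qed

lemma parabola_integral:
  fixes a b :: real
  assumes "a \<le> b"
  shows "((\<lambda>t. 2 * (1 - t)) has_integral (2 * b - b\<^sup>2) - (2 * a - a\<^sup>2)) {a..b}"
  using assms by (intro fundamental_theorem_of_calculus)
    (auto intro!: derivative_eq_intros simp flip: has_real_derivative_iff_has_vector_derivative)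

text \<open>
  With \<open>r = (1 - t)\<^sup>2\<close> this is the Beta integral of \<open>(k + 1) (1 - r)\<^sup>k r\<^sup>j\<close> over \<open>[0, 1]\<close>.
  One integration by parts lowers \<open>j\<close> and raises \<open>k\<close>.
\<close>

lemma beta_integral:
  "((\<lambda>t::real. real (Suc k) * (2 * t - t\<^sup>2) ^ k * (2 * (1 - t)) * (1 - t) ^ (2 * j))
    has_integral 1 / real ((j + Suc k) choose Suc k)) {0..1}"
proof (induction j arbitrary: k)
  case 0
  have "((\<lambda>t::real. real (Suc k) * (2 * t - t\<^sup>2) ^ k * (2 * (1 - t))) has_integral
      (2 * 1 - 1\<^sup>2) ^ Suc k - (2 * 0 - 0\<^sup>2) ^ Suc k) {0..1}"
    by (intro fundamental_theorem_of_calculus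
        has_derivative_parabola_power[unfolded has_real_derivative_iff_has_vector_derivative]) simp
  then show ?case by simp
next
  case (Suc j)
  let ?S = "\<lambda>t::real. 2 * t - t\<^sup>2"
  \<comment> \<open>The derivative of the product of \<open>?S\<close> to the \<open>k + 1\<close> and \<open>1 - t\<close> to the \<open>2 (j + 1)\<close>,
    which vanishes at both ends.\<close>
  define G' where "G' = (\<lambda>t. real (Suc k) * ?S t ^ k * (2 * (1 - t)) * (1 - t) ^ (2 * Suc j)
    - real (Suc j) / real (Suc (Suc k)) *
      (real (Suc (Suc k)) * ?S t ^ Suc k * (2 * (1 - t)) * (1 - t) ^ (2 * j)))"
  have "(G' has_integral ?S 1 ^ Suc k * (1 - 1) ^ (2 * Suc j) - ?S 0 ^ Suc k * (1 - 0) ^ (2 * Suc j)) {0..1}"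
  proof (intro fundamental_theorem_of_calculus)
    fix t :: real
    have "((\<lambda>t. ?S t ^ Suc k * (1 - t) ^ (2 * Suc j)) has_real_derivative G' t) (at t within {0..1})"
    proof -
      have lin: "((\<lambda>t::real. 1 - t) has_real_derivative -1) (at t within {0..1})"
        by (auto intro!: derivative_eq_intros)
      have pow: "((\<lambda>t::real. (1 - t) ^ (2 * Suc j)) has_real_derivative
          - (2 * real (Suc j) * (1 - t) * (1 - t) ^ (2 * j))) (at t within {0..1})"
        using DERIV_power[OF lin, of "2 * Suc j"] by (simp add: ac_simps)
      have "G' t = real (Suc k) * ?S t ^ k * (2 * (1 - t)) * (1 - t) ^ (2 * Suc j)
          + - (2 * real (Suc j) * (1 - t) * (1 - t) ^ (2 * j)) * ?S t ^ Suc k"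
        by (simp add: G'_def del: power_Suc of_nat_Suc)
      then show ?thesis
        using DERIV_mult[OF has_derivative_parabola_power[of k t "{0..1}"] pow] by simp
    qed
    then show "((\<lambda>t. ?S t ^ Suc k * (1 - t) ^ (2 * Suc j)) has_vector_derivative G' t) (at t within {0..1})"
      by (simp add: has_real_derivative_iff_has_vector_derivative)
  qed simp
  then have 1: "(G' has_integral 0) {0..1}" by simp
  from has_integral_add[OF this has_integral_mult_right[OF Suc.IH[of "Suc k"], of "real (Suc j) / real (Suc (Suc k))"]]
  have "((\<lambda>t. real (Suc k) * ?S t ^ k * (2 * (1 - t)) * (1 - t) ^ (2 * Suc j)) has_integral
     real (Suc j) / real (Suc (Suc k)) * (1 / real ((j + Suc (Suc k)) choose Suc (Suc k)))) {0..1}"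
    by (simp add: G'_def)
  moreover have "real (Suc j) / real (Suc (Suc k)) * (1 / real ((j + Suc (Suc k)) choose Suc (Suc k)))
    = 1 / real ((Suc j + Suc k) choose Suc k)"
  proof -
    have "Suc (Suc k) * ((j + Suc (Suc k)) choose Suc (Suc k)) = Suc j * ((Suc j + Suc k) choose Suc k)"
      using Suc_times_binomial_add[of "Suc k" j] by (simp add: ac_simps)
    then have "real (Suc (Suc k)) * real ((j + Suc (Suc k)) choose Suc (Suc k))
      = real (Suc j) * real ((Suc j + Suc k) choose Suc k)"
      by (metis of_nat_mult)
    moreover have "real ((j + Suc (Suc k)) choose Suc (Suc k)) > 0" "real ((Suc j + Suc k) choose Suc k) > 0"
      by (simp_all add: zero_less_binomial del: binomial_Suc_Suc)
    ultimately show ?thesis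
      by (simp add: divide_eq_eq eq_divide_eq del: binomial_Suc_Suc of_nat_Suc)
  qed
  ultimately show ?case by metis
qed

text \<open>
  The weight of degree at least \<open>k + 1\<close> as an integral of noisy energies of the derivatives of
  order \<open>k + 1\<close>, over the noise parameter \<open>\<rho> = 1 - t\<close>. The Beta integral is the reciprocal of the
  binomial coefficient that counts the subsets of a given \<open>S\<close>.
\<close>

lemma W_ge_integral:
  "((\<lambda>t. real (Suc k) * (2 * t - t\<^sup>2) ^ k * (2 * (1 - t)) *
      (\<Sum>J | J \<subseteq> {1..n} \<and> card J = Suc k. noise_energy n (1 - t) (D_set J f)))
    has_integral W_ge n (Suc k) f) {0..1}"
proof -
  define T where "T = {S. S \<subseteq> {1..n} \<and> Suc k \<le> card S}"
  have finT: "finite T" by (auto simp: T_def intro: finite_subset[of _ "Pow {1..n}"])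
  define K where "K = (\<lambda>t::real. real (Suc k) * (2 * t - t\<^sup>2) ^ k * (2 * (1 - t)))"
  have one: "((\<lambda>t. K t * (real (card S choose Suc k) * (1 - t) ^ (2 * (card S - Suc k)) * (fourier n f S)\<^sup>2))
      has_integral (fourier n f S)\<^sup>2) {0..1}" if S: "S \<in> T" for S
  proof -
    define j where "j = card S - Suc k"
    have j: "card S = j + Suc k" using S by (auto simp: T_def j_def)
    have pos: "real (card S choose Suc k) > 0"
      using j by (simp add: zero_less_binomial del: binomial_Suc_Suc)
    from has_integral_mult_left[OF beta_integral[of k j], of "real (card S choose Suc k) * (fourier n f S)\<^sup>2"]
    show ?thesis using pos by (simp add: K_def j ac_simps del: binomial_Suc_Suc of_nat_Suc)
  qed
  have "((\<lambda>t. \<Sum>S\<in>T. K t * (real (card S choose Suc k) * (1 - t) ^ (2 * (card S - Suc k)) * (fourier n f S)\<^sup>2))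
      has_integral (\<Sum>S\<in>T. (fourier n f S)\<^sup>2)) {0..1}"
    using one finT by (intro has_integral_sum) auto
  then show ?thesis
    unfolding sum_noise_energy_D_set W_ge_eq T_def K_def by (simp only: sum_distrib_left)
qed

text \<open>
  This reduces the order \<open>k + 1\<close> to order one. Let \<open>A\<close> be the running integral of
  \<open>2 (1 - s) v s\<close>. As \<open>v\<close> decreases, \<open>A t\<close> is at least \<open>(2 t - t\<^sup>2) v t\<close>, so the integrand on the left
  is at most the derivative of the power \<open>k + 1\<close> of \<open>A\<close>. In probabilistic terms, for \<open>k + 1\<close> independent variables with
  distribution function \<open>2 t - t\<^sup>2\<close>, the left-hand side is the expectation of \<open>v\<^bsup>k+1\<^esup>\<close> at
  their maximum, the right-hand side that of the product of the values of \<open>v\<close> at all of them.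
\<close>

lemma weighted_power_integral_le:
  fixes v :: "real \<Rightarrow> real"
  assumes cont: "continuous_on {0..1} v"
    and anti: "\<And>s t. 0 \<le> s \<Longrightarrow> s \<le> t \<Longrightarrow> t \<le> 1 \<Longrightarrow> v t \<le> v s"
    and nonneg: "\<And>t. 0 \<le> t \<Longrightarrow> t \<le> 1 \<Longrightarrow> 0 \<le> v t"
  shows "integral {0..1} (\<lambda>t. real (Suc k) * (2 * t - t\<^sup>2) ^ k * (2 * (1 - t)) * v t ^ Suc k)
    \<le> integral {0..1} (\<lambda>t. 2 * (1 - t) * v t) ^ Suc k"
proof -
  define A where "A = (\<lambda>t. integral {0..t} (\<lambda>s. 2 * (1 - s) * v s))"
  have c: "continuous_on {0..1} (\<lambda>s. 2 * (1 - s) * v s)" by (intro continuous_intros cont)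
  have A': "(A has_real_derivative 2 * (1 - t) * v t) (at t within {0..1})" if "t \<in> {0..1}" for t
    unfolding A_def has_real_derivative_iff_has_vector_derivative
    using integral_has_vector_derivative[OF c that] .
  have A_ge: "(2 * t - t\<^sup>2) * v t \<le> A t" if t: "t \<in> {0..1}" for t
  proof (rule has_integral_le)
    show "((\<lambda>s. 2 * (1 - s) * v s) has_integral A t) {0..t}"
      unfolding A_def using t
      by (intro integrable_integral integrable_continuous_interval continuous_on_subset[OF c]) auto
    from has_integral_mult_left[OF parabola_integral[of 0 t], of "v t"] t
    show "((\<lambda>s. 2 * (1 - s) * v t) has_integral (2 * t - t\<^sup>2) * v t) {0..t}" by simp
    show "2 * (1 - s) * v t \<le> 2 * (1 - s) * v s" if "s \<in> {0..t}" for s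
      using that t anti[of s t] by (intro mult_left_mono) auto
  qed
  have "integral {0..1} (\<lambda>t. real (Suc k) * (2 * t - t\<^sup>2) ^ k * (2 * (1 - t)) * v t ^ Suc k) \<le> A 1 ^ Suc k - A 0 ^ Suc k"
  proof (rule has_integral_le)
    show "((\<lambda>t. real (Suc k) * (2 * t - t\<^sup>2) ^ k * (2 * (1 - t)) * v t ^ Suc k) has_integral
        integral {0..1} (\<lambda>t. real (Suc k) * (2 * t - t\<^sup>2) ^ k * (2 * (1 - t)) * v t ^ Suc k)) {0..1}"
      by (intro integrable_integral integrable_continuous_interval continuous_intros cont)
    show "((\<lambda>t. real (Suc k) * A t ^ k * (2 * (1 - t) * v t)) has_integral A 1 ^ Suc k - A 0 ^ Suc k) {0..1}"
    proof (rule fundamental_theorem_of_calculus)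
      fix t :: real assume t: "t \<in> {0..1}"
      show "((\<lambda>t. A t ^ Suc k) has_vector_derivative real (Suc k) * A t ^ k * (2 * (1 - t) * v t)) (at t within {0..1})"
        unfolding has_real_derivative_iff_has_vector_derivative[symmetric]
        using DERIV_power[OF A'[OF t], of "Suc k"] by (simp add: algebra_simps)
    qed simp
    fix t :: real assume t: "t \<in> {0..1}"
    have "((2 * t - t\<^sup>2) * v t) ^ k \<le> A t ^ k"
      using A_ge[OF t] nonneg[of t] t mult_right_mono[of t 1 t]
      by (intro power_mono mult_nonneg_nonneg) (auto simp: power2_eq_square)
    then have "real (Suc k) * (2 * (1 - t) * v t) * ((2 * t - t\<^sup>2) * v t) ^ k
        \<le> real (Suc k) * (2 * (1 - t) * v t) * A t ^ k"
      using t nonneg[of t] by (intro mult_left_mono mult_nonneg_nonneg) auto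
    then show "real (Suc k) * (2 * t - t\<^sup>2) ^ k * (2 * (1 - t)) * v t ^ Suc k
        \<le> real (Suc k) * A t ^ k * (2 * (1 - t) * v t)"
      by (simp add: power_mult_distrib ac_simps)
  qed
  moreover have "A 0 = 0" by (simp add: A_def)
  ultimately show ?thesis by (simp add: A_def)
qed

section \<open>The first-order integral and the constant\<close>

lemma truncated_exp_integral:
  fixes L q :: real
  assumes L: "0 < L" and q: "0 \<le> q" "q \<le> 1"
  shows "integral {0..1} (\<lambda>t. 2 * (1 - t) * exp (- L * min t q))
    = (1 - q)\<^sup>2 * exp (- L * q) + 2 * (1 - (1 - q) * exp (- L * q)) / L - 2 * (1 - exp (- L * q)) / L\<^sup>2"
proof -
  let ?g = "\<lambda>t. 2 * (1 - t) * exp (- L * min t q)"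
  define F where "F = (\<lambda>t. - 2 * (1 - t) * exp (- L * t) / L + 2 * exp (- L * t) / L\<^sup>2)"
  have "((\<lambda>t. 2 * (1 - t) * exp (- L * t)) has_integral F q - F 0) {0..q}"
  proof (rule fundamental_theorem_of_calculus[OF q(1)])
    fix t
    have "(F has_real_derivative 2 * (1 - t) * exp (- L * t)) (at t within {0..q})"
      unfolding F_def using L
      by (auto intro!: derivative_eq_intros simp: field_simps power2_eq_square)
    then show "(F has_vector_derivative 2 * (1 - t) * exp (- L * t)) (at t within {0..q})"
      by (simp add: has_real_derivative_iff_has_vector_derivative)
  qed
  then have 1: "(?g has_integral F q - F 0) {0..q}"
    by (rule has_integral_eq[rotated]) (auto simp: min_def)
  have "((\<lambda>t. 2 * (1 - t) * exp (- L * q)) has_integral (1 - q)\<^sup>2 * exp (- L * q)) {q..1}"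
  proof -
    have "(2 * 1 - 1\<^sup>2) - (2 * q - q\<^sup>2) = (1 - q)\<^sup>2"
      by (simp add: power2_eq_square algebra_simps)
    then show ?thesis
      using has_integral_mult_left[OF parabola_integral[OF q(2)], of "exp (- L * q)"] by (simp only:)
  qed
  then have 2: "(?g has_integral (1 - q)\<^sup>2 * exp (- L * q)) {q..1}"
    by (rule has_integral_eq[rotated]) (auto simp: min_def)
  have "(?g has_integral F q - F 0 + (1 - q)\<^sup>2 * exp (- L * q)) {0..1}"
    using has_integral_combine[OF q 1 2] .
  then have "integral {0..1} ?g = F q - F 0 + (1 - q)\<^sup>2 * exp (- L * q)"
    by (rule integral_unique)
  then show ?thesis by (simp add: F_def diff_divide_distrib add_divide_distrib algebra_simps)
qed

lemma x_exp_minus_le: "x * exp (- x) \<le> exp (-1 :: real)"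
proof -
  have "x \<le> exp (x - 1)" using exp_ge_add_one_self[of "x - 1"] by simp
  then have "x * exp (- x) \<le> exp (x - 1) * exp (- x)" by (intro mult_right_mono) auto
  then show ?thesis by (simp flip: exp_add)
qed

text \<open>
  Integrating \<open>x e\<^bsup>-x\<^esup> \<le> 1 / e\<close> from \<open>0\<close>; integrating the result once more gives
  \<open>exp_remainder_2\<close>.
\<close>

lemma exp_remainder_1:
  fixes x :: real
  assumes "0 \<le> x"
  shows "1 - exp (- x) * (1 + x) \<le> x * exp (-1)"
proof -
  define g :: "real \<Rightarrow> real" where "g = (\<lambda>x. x * exp (-1) - 1 + exp (- x) * (1 + x))"
  have "g 0 \<le> g x"
  proof (rule DERIV_nonneg_imp_nondecreasing[OF assms])
    fix y :: real
    have "(g has_real_derivative exp (-1) - y * exp (- y)) (at y)"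
      unfolding g_def by (auto intro!: derivative_eq_intros simp: algebra_simps)
    then show "\<exists>d. (g has_real_derivative d) (at y) \<and> 0 \<le> d"
      using x_exp_minus_le[of y] by (intro exI[of _ "exp (-1) - y * exp (- y)"]) simp
  qed
  then show ?thesis by (simp add: g_def)
qed

lemma exp_remainder_2:
  fixes x :: real
  assumes "0 \<le> x"
  shows "x * (1 + exp (- x)) - 2 * (1 - exp (- x)) \<le> x\<^sup>2 * exp (-1) / 2"
proof -
  define g :: "real \<Rightarrow> real"
    where "g = (\<lambda>x. x\<^sup>2 * exp (-1) / 2 - x * (1 + exp (- x)) + 2 * (1 - exp (- x)))"
  have "g 0 \<le> g x"
  proof (rule DERIV_nonneg_imp_nondecreasing[OF assms])
    fix y :: real assume y: "0 \<le> y" "y \<le> x"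
    have "(g has_real_derivative y * exp (-1) - (1 - exp (- y) * (1 + y))) (at y)"
      unfolding g_def by (auto intro!: derivative_eq_intros simp: algebra_simps)
    then show "\<exists>d. (g has_real_derivative d) (at y) \<and> 0 \<le> d"
      using exp_remainder_1[OF y(1)] by (intro exI[of _ "y * exp (-1) - (1 - exp (- y) * (1 + y))"]) simp
  qed
  then show ?thesis by (simp add: g_def)
qed

text \<open>
  This is where the constant \<^const>\<open>C\<close> comes from. With \<open>x = L q\<close> the excess of the left-hand side over
  \<open>2\<close>, times \<open>q\<close>, is a combination with nonnegative weights of \<open>x e\<^bsup>-x\<^esup>\<close> and its two
  integrated and rescaled versions \<open>G\<close> and \<open>H\<close>. They are at most \<open>1 / e\<close>, \<open>2 / e\<close> and \<open>1 / e\<close>, which adds up to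
  \<open>1 - q (1 - q) (2 - q) \<le> 1\<close> times \<open>1 / e\<close>.
\<close>

lemma truncated_exp_integral_bound:
  fixes L q :: real
  assumes L: "0 \<le> L" and q: "0 < q" "q \<le> 1"
  shows "integral {0..1} (\<lambda>t. 2 * (1 - t) * exp (- L * min t q)) * (2 + L) \<le> 2 + exp (-1) / q"
proof (cases "L = 0")
  case True
  show ?thesis using integral_unique[OF parabola_integral[of 0 1]] True q by simp
next
  case False
  then have L: "L > 0" using L by simp
  define x where "x = L * q"
  define E where "E = exp (- x)"
  define c :: real where "c = exp (-1)"
  define G where "G = 2 * (1 - E * (1 + x)) / x"
  define H where "H = 2 * (x * (1 + E) - 2 * (1 - E)) / x\<^sup>2"
  define U where "U = (1 - q)\<^sup>2 * E + 2 * (1 - (1 - q) * E) / L - 2 * (1 - E) / L\<^sup>2"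
  have x: "x > 0" "L = x / q" using L q by (auto simp: x_def)
  have U: "integral {0..1} (\<lambda>t. 2 * (1 - t) * exp (- L * min t q)) = U"
    unfolding U_def E_def x_def using truncated_exp_integral[OF L, of q] q by simp
  have c: "c > 0" by (simp add: c_def)
  have xE: "x * E \<le> c" using x_exp_minus_le[of x] by (simp add: E_def c_def)
  have G: "G \<le> 2 * c" using exp_remainder_1[of x] x by (simp add: G_def E_def c_def field_simps)
  have H: "H \<le> c" using exp_remainder_2[of x] x by (simp add: H_def E_def c_def field_simps)
  have "q * (U * (2 + L) - 2) = (1 - q)\<^sup>2 * (x * E) + q\<^sup>2 * (1 - q) * G + q ^ 3 * H"
    unfolding U_def G_def H_def x(2) using x(1) q
    by (simp add: field_simps power2_eq_square power3_eq_cube)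
  also have "\<dots> \<le> (1 - q)\<^sup>2 * c + q\<^sup>2 * (1 - q) * (2 * c) + q ^ 3 * c"
    using q xE G H by (intro add_mono mult_left_mono) auto
  also have "\<dots> = c - c * (q * (1 - q) * (2 - q))"
    by (simp add: algebra_simps power2_eq_square power3_eq_cube)
  also have "\<dots> \<le> c" using c q by simp
  finally have "U * (2 + L) - 2 \<le> c / q" using q by (simp add: field_simps)
  then show ?thesis unfolding U by (simp add: c_def)
qed

section \<open>The inequality for one order\<close>

text \<open>
  For a function bounded by \<open>1\<close>, its norm of exponent \<open>1 + \<rho>\<^sup>2\<close> is controlled by the mean of
  \<open>\<bar>g\<bar>\<^sup>p\<close> as long as \<open>1 + \<rho>\<^sup>2 \<ge> p\<close>. For smaller \<open>\<rho>\<close>, the energy increases with \<open>\<rho>\<close>, so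
  \<open>\<rho>\<close> may be replaced by \<open>sqrt (p - 1)\<close>; hence the truncation of the exponent at \<open>2 / p - 1\<close>.
\<close>

lemma noise_energy_le_powr:
  assumes g: "\<And>x. x \<in> cube n \<Longrightarrow> \<bar>g x\<bar> \<le> 1"
    and M: "cube_avg n (\<lambda>x. \<bar>g x\<bar> powr p) \<le> M" "M \<le> 1"
    and p: "1 \<le> p" "p < 2" and t: "0 \<le> t" "t \<le> 1"
  shows "noise_energy n (1 - t) g \<le> M powr (1 + min t (2 / p - 1))"
proof -
  define \<sigma> where "\<sigma> = max (1 - t) (sqrt (p - 1))"
  have \<sigma>: "0 \<le> \<sigma>" "\<sigma> \<le> 1" "1 - t \<le> \<sigma>" using t p by (auto simp: \<sigma>_def)
  have pos: "1 + \<sigma>\<^sup>2 > 0" using zero_le_power2[of \<sigma>] by linarith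
  have "sqrt (p - 1) \<le> \<sigma>" by (simp add: \<sigma>_def)
  then have "(sqrt (p - 1))\<^sup>2 \<le> \<sigma>\<^sup>2" using p by (intro power_mono) auto
  then have p\<sigma>: "p \<le> 1 + \<sigma>\<^sup>2" using p by simp
  have M0: "0 \<le> M" using M(1) cube_avg_nonneg[of n "\<lambda>x. \<bar>g x\<bar> powr p"] by simp
  have expo: "1 + min t (2 / p - 1) \<le> 2 / (1 + \<sigma>\<^sup>2)"
  proof (cases "1 - t \<le> sqrt (p - 1)")
    case True
    then have "\<sigma>\<^sup>2 = p - 1" using p by (simp add: \<sigma>_def)
    then show ?thesis by simp
  next
    case False
    then have \<sigma>t: "\<sigma> = 1 - t" by (simp add: \<sigma>_def)
    \<comment> \<open>Here \<open>2 / (1 + \<rho>\<^sup>2)\<close> is replaced by the smaller \<open>2 - \<rho> = 1 + t\<close>, an exponent linear in \<open>t\<close>,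
      so that the final integral is elementary.\<close>
    have "(1 + t) * (1 + \<sigma>\<^sup>2) = 2 - \<sigma> * (1 - \<sigma>)\<^sup>2"
      by (simp add: \<sigma>t power2_eq_square algebra_simps)
    also have "\<dots> \<le> 2" using \<sigma> by simp
    finally have "1 + t \<le> 2 / (1 + \<sigma>\<^sup>2)" using pos by (simp add: field_simps)
    then show ?thesis by linarith
  qed
  have "noise_energy n (1 - t) g \<le> noise_energy n \<sigma> g"
    using \<sigma> t by (intro noise_energy_mono) auto
  also have "\<dots> \<le> cube_avg n (\<lambda>x. \<bar>g x\<bar> powr (1 + \<sigma>\<^sup>2)) powr (2 / (1 + \<sigma>\<^sup>2))"
    using \<sigma> by (intro hypercontractivity) auto
  also have "\<dots> \<le> cube_avg n (\<lambda>x. \<bar>g x\<bar> powr p) powr (2 / (1 + \<sigma>\<^sup>2))"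
    using pos p\<sigma> g by (intro powr_mono2 cube_avg_mono cube_avg_nonneg powr_mono') auto
  also have "\<dots> \<le> M powr (2 / (1 + \<sigma>\<^sup>2))"
    using pos M by (intro powr_mono2 cube_avg_nonneg) auto
  also have "\<dots> \<le> M powr (1 + min t (2 / p - 1))"
    using expo M M0 by (intro powr_mono') auto
  finally show ?thesis .
qed

text \<open>
  The derivative \<open>1/2 - (ln y)/2\<close> is positive on \<open>(0, 1]\<close>; the estimate \<open>ln x \<le> x - 1\<close> gives
  the monotonicity without differentiation.
\<close>

lemma entropy_term_mono:
  fixes y z :: real
  assumes "0 < y" "y \<le> z" "z \<le> 1"
  shows "y * (1 - ln y / 2) \<le> z * (1 - ln z / 2)"
proof -
  have z: "z > 0" "ln z \<le> 0" using assms by auto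
  have "ln (z / y) \<le> z / y - 1" using assms z by (intro ln_le_minus_one) auto
  then have "y * ln (z / y) \<le> z - y" using assms by (simp add: field_simps)
  then have "y * (1 - ln y / 2) \<le> y * (1 - ln z / 2) + (z - y) / 2"
    using assms z by (simp add: ln_div algebra_simps diff_divide_distrib)
  also have "\<dots> \<le> y * (1 - ln z / 2) + (z - y) * (1 - ln z / 2)"
    using mult_left_mono[of "1 / 2" "1 - ln z / 2" "z - y"] assms z by simp
  also have "\<dots> = z * (1 - ln z / 2)" by (simp add: algebra_simps diff_divide_distrib)
  finally show ?thesis .
qed

lemma neg_mult_ln_le: "0 < u \<Longrightarrow> - u * ln u \<le> exp (-1 :: real)"
  using ln_le_minus_one[of "exp (-1) / u"] by (simp add: ln_div field_simps)

text \<open>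
  The bound \<open>le\<close> controls \<open>w\<close> in terms of \<open>M\<close>, with the logarithm of \<open>M\<close> hidden in \<open>u\<close>; here it is
  turned into a lower bound for \<open>M\<close> in terms of \<open>w\<close>. Take \<open>m\<close>-th roots \<open>\<omega>\<close> and \<open>\<mu>\<close> of \<open>w\<close> and \<open>M\<close>.
  By \<open>entropy_term_mono\<close>, \<open>\<omega>\<close> may be replaced by its upper bound \<open>\<mu> u\<close>. What remains is
  \<open>ub\<close> plus the entropy \<open>- u ln u \<le> 1 / e\<close>, and
  \<open>1 / (2 - p)\<close> is the mean of \<open>1 / (2 / p - 1)\<close> and \<open>1\<close>.
\<close>

lemma solve_for_maximum:
  fixes M u w p :: real and m :: nat
  assumes m: "m > 0" and M: "0 < M" "M \<le> 1" and u: "0 < u" "u \<le> 1" and w: "0 < w"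
    and le: "w \<le> M * u ^ m" and p: "1 \<le> p" "p < 2"
    and ub: "u * (2 - ln M / real m) \<le> 2 + exp (-1) / (2 / p - 1)"
  shows "C p ^ m * w * (1 + 1 / (2 * real m) * ln (1 / w)) ^ m \<le> M"
proof -
  define \<omega> where "\<omega> = exp (ln w / m)"
  define \<mu> where "\<mu> = exp (ln M / m)"
  have \<omega>: "\<omega> > 0" "\<omega> ^ m = w" "ln \<omega> = ln w / m"
    using m w by (simp_all add: \<omega>_def exp_of_nat_mult[symmetric])
  have \<mu>: "0 < \<mu>" "\<mu> \<le> 1" "\<mu> ^ m = M" "ln \<mu> = ln M / m"
    using m M by (simp_all add: \<mu>_def exp_of_nat_mult[symmetric] divide_nonpos_pos)
  have "\<omega> ^ m \<le> (\<mu> * u) ^ m" using le by (simp add: \<omega> \<mu> power_mult_distrib)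
  then have \<omega>\<mu>: "\<omega> \<le> \<mu> * u" using m \<omega> \<mu> u by (subst (asm) power_mono_iff) auto
  have \<mu>u: "\<mu> * u \<le> 1" using \<mu> u mult_mono[of \<mu> 1 u 1] by simp
  have "\<omega> * (1 - ln \<omega> / 2) \<le> (\<mu> * u) * (1 - ln (\<mu> * u) / 2)"
    using entropy_term_mono \<omega> \<omega>\<mu> \<mu>u by blast
  also have "\<dots> = \<mu> * ((u * (2 - ln M / m) + - u * ln u) / 2)"
    using \<mu> u by (simp add: ln_mult field_simps)
  also have "\<dots> \<le> \<mu> * ((2 + exp (-1) / (2 / p - 1) + exp (-1)) / 2)"
    using ub neg_mult_ln_le[OF u(1)] \<mu> by (intro mult_left_mono divide_right_mono add_mono) auto
  also have "(2 + exp (-1) / (2 / p - 1) + exp (-1)) / 2 = 1 + 1 / (exp 1 * (2 - p))"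
    using p by (simp add: exp_minus field_simps)
  also have "\<mu> * (1 + 1 / (exp 1 * (2 - p))) = \<mu> / C p" by (simp add: C_def field_simps)
  finally have main: "\<omega> * (1 - ln \<omega> / 2) \<le> \<mu> / C p" .
  have Cp: "C p > 0" using p by (simp add: C_def add_pos_pos)
  have "ln \<omega> \<le> 0" using \<omega>(1) \<omega>\<mu> \<mu>u by (subst ln_le_zero_iff) auto
  then have "0 \<le> C p * (\<omega> * (1 - ln \<omega> / 2))"
    using Cp less_imp_le[OF \<omega>(1)] by (intro mult_nonneg_nonneg) linarith+
  moreover have "C p * (\<omega> * (1 - ln \<omega> / 2)) \<le> \<mu>" using main Cp by (simp add: field_simps)
  ultimately have "(C p * (\<omega> * (1 - ln \<omega> / 2))) ^ m \<le> \<mu> ^ m" by (intro power_mono)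
  then have "C p ^ m * w * (1 - ln \<omega> / 2) ^ m \<le> M"
    by (simp add: power_mult_distrib \<omega>(2) \<mu>(3) mult.assoc)
  moreover have "1 - ln \<omega> / 2 = 1 + 1 / (2 * real m) * ln (1 / w)"
    using w by (simp add: \<omega>(3) ln_div)
  ultimately show ?thesis by simp
qed

text \<open>
  The integral formula, with each noisy energy bounded by hypercontractivity, gives
  \<open>W / N \<le> M u\<^bsup>k+1\<^esup>\<close>, where the powers of \<open>M\<close> in excess of the first are written as
  \<open>v\<^bsup>k+1\<^esup>\<close> with \<open>v t = e\<close> to the \<open>- L min t q\<close>.
\<close>

lemma level_inequality_pos:
  assumes k: "Suc k \<le> n" and f: "\<And>x. x \<in> cube n \<Longrightarrow> \<bar>f x\<bar> \<le> 1" and p: "1 \<le> p" "p < 2"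
    and M: "\<And>J. J \<subseteq> {1..n} \<Longrightarrow> card J = Suc k \<Longrightarrow> cube_avg n (\<lambda>x. \<bar>D_set J f x\<bar> powr p) \<le> M"
    and M1: "0 \<le> M" "M \<le> 1"
  shows "C p ^ Suc k * (W_ge n (Suc k) f / real (n choose Suc k)) *
    (1 + 1 / (2 * real (Suc k)) * ln (real (n choose Suc k) / W_ge n (Suc k) f)) ^ Suc k \<le> M"
proof -
  define N where "N = real (n choose Suc k)"
  define W where "W = W_ge n (Suc k) f"
  define q where "q = 2 / p - 1"
  define L where "L = - ln M / real (Suc k)"
  define v where "v = (\<lambda>t. exp (- L * min t q))"
  define u where "u = integral {0..1} (\<lambda>t. 2 * (1 - t) * v t)"
  define K where "K = (\<lambda>t::real. real (Suc k) * (2 * t - t\<^sup>2) ^ k * (2 * (1 - t)))"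
  have N: "N > 0" using k by (simp add: N_def zero_less_binomial del: binomial_Suc_Suc)
  have W0: "W \<ge> 0" by (simp add: W_def W_ge_eq sum_nonneg)
  show ?thesis
  proof (cases "W = 0")
    case True
    \<comment> \<open>The right-hand side vanishes, whatever \<open>ln (N / 0)\<close> is.\<close>
    then show ?thesis using M1 by (simp add: W_def)
  next
    case False
    then have W: "W > 0" using W0 by simp
    have q: "0 < q" "q \<le> 1" using p by (auto simp: q_def field_simps)
    have K0: "0 \<le> K t" if "t \<in> {0..1}" for t
      using that mult_right_mono[of t 1 t] unfolding K_def
      by (intro mult_nonneg_nonneg zero_le_power) (auto simp: power2_eq_square)
    have energy: "(\<Sum>J | J \<subseteq> {1..n} \<and> card J = Suc k. noise_energy n (1 - t) (D_set J f))
        \<le> N * M powr (1 + min t q)" if t: "t \<in> {0..1}" for t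
    proof -
      have "(\<Sum>J | J \<subseteq> {1..n} \<and> card J = Suc k. noise_energy n (1 - t) (D_set J f))
        \<le> (\<Sum>J | J \<subseteq> {1..n} \<and> card J = Suc k. M powr (1 + min t q))"
        unfolding q_def using f M M1 p t
        by (intro sum_mono noise_energy_le_powr D_set_bounded[of n f]) auto
      also have "\<dots> = N * M powr (1 + min t q)" by (simp add: n_subsets N_def)
      finally show ?thesis .
    qed
    have rep: "((\<lambda>t. K t * (\<Sum>J | J \<subseteq> {1..n} \<and> card J = Suc k. noise_energy n (1 - t) (D_set J f)))
        has_integral W) {0..1}"
      using W_ge_integral[of k n f] by (simp add: K_def W_def)
    \<comment> \<open>Needed because \<open>ln 0 = 0\<close>: for \<open>M = 0\<close> the rate \<open>L\<close> would be meaningless.\<close>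
    have Mpos: "M > 0"
    proof (rule ccontr)
      assume "\<not> M > 0"
      then have "M = 0" using M1 by simp
      have "W \<le> 0"
      proof (rule has_integral_le[OF rep has_integral_is_0])
        fix t :: real assume t: "t \<in> {0..1}"
        show "K t * (\<Sum>J | J \<subseteq> {1..n} \<and> card J = Suc k. noise_energy n (1 - t) (D_set J f)) \<le> 0"
          using K0[OF t] energy[OF t] \<open>M = 0\<close> by (simp add: mult_nonneg_nonpos)
      qed simp
      then show False using W by simp
    qed
    have L: "L \<ge> 0" using Mpos M1 by (simp add: L_def divide_nonpos_pos)
    have v_cont: "continuous_on {0..1} v" unfolding v_def by (intro continuous_intros)
    have vk: "M powr (1 + min t q) = M * v t ^ Suc k" for t
    proof -
      have "v t ^ Suc k = exp (min t q * ln M)"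
        unfolding v_def exp_of_nat_mult[symmetric] by (simp add: L_def del: of_nat_Suc)
      then show ?thesis using Mpos by (simp add: powr_def distrib_right exp_add)
    qed
    have Kv: "(\<lambda>t. K t * v t ^ Suc k) integrable_on {0..1}"
      unfolding K_def by (intro integrable_continuous_interval continuous_intros v_cont)
    have "W \<le> N * M * integral {0..1} (\<lambda>t. K t * v t ^ Suc k)"
    proof (rule has_integral_le[OF rep has_integral_mult_right[OF integrable_integral[OF Kv]]])
      fix t :: real assume t: "t \<in> {0..1}"
      show "K t * (\<Sum>J | J \<subseteq> {1..n} \<and> card J = Suc k. noise_energy n (1 - t) (D_set J f))
          \<le> N * M * (K t * v t ^ Suc k)"
        using mult_left_mono[OF energy[OF t] K0[OF t]] unfolding vk by (simp only: ac_simps)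
    qed
    also have "\<dots> \<le> N * M * u ^ Suc k"
      unfolding u_def K_def using N Mpos L
      by (intro mult_left_mono weighted_power_integral_le[OF v_cont])
        (auto simp: v_def mult_left_mono)
    finally have le: "W / N \<le> M * u ^ Suc k" using N by (simp add: field_simps)
    have u0: "0 \<le> u"
      unfolding u_def by (intro integral_nonneg integrable_continuous_interval continuous_intros v_cont)
        (auto simp: v_def)
    have "u \<noteq> 0" using le W N Mpos by (auto simp: divide_le_0_iff)
    then have "u > 0" using u0 by simp
    have "u \<le> 1"
      unfolding u_def
    proof (rule has_integral_le[OF integrable_integral])
      show "(\<lambda>t. 2 * (1 - t) * v t) integrable_on {0..1}"
        by (intro integrable_continuous_interval continuous_intros v_cont)
      show "((\<lambda>t::real. 2 * (1 - t)) has_integral 1) {0..1}"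
        using parabola_integral[of 0 1] by simp
      show "2 * (1 - t) * v t \<le> 2 * (1 - t)" if "t \<in> {0..1}" for t
        using that L q mult_left_mono[of "v t" 1 "2 * (1 - t)"] by (simp add: v_def)
    qed
    have "u * (2 + L) \<le> 2 + exp (-1) / q"
      unfolding u_def v_def using truncated_exp_integral_bound[OF L q] .
    then have "C p ^ Suc k * (W / N) * (1 + 1 / (2 * real (Suc k)) * ln (1 / (W / N))) ^ Suc k \<le> M"
      using \<open>u > 0\<close> \<open>u \<le> 1\<close> le W N Mpos M1 p
      by (intro solve_for_maximum) (auto simp: L_def q_def)
    then show ?thesis by (simp add: W_def N_def)
  qed
qed

text \<open>
  For order \<open>0\<close> there is no logarithmic gain: squaring only decreases numbers in \<open>[0, 1]\<close>
  compared with the power \<open>p < 2\<close>.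
\<close>

lemma level_inequality_0:
  assumes f: "\<And>x. x \<in> cube n \<Longrightarrow> \<bar>f x\<bar> \<le> 1" and p: "1 \<le> p" "p < 2"
  shows "W_ge n 0 f \<le> cube_avg n (\<lambda>x. \<bar>f x\<bar> powr p)"
proof -
  have "W_ge n 0 f = noise_energy n 1 f"
    unfolding W_ge_eq noise_energy_def by (intro sum.cong) auto
  also have "\<dots> = cube_avg n (\<lambda>x. \<bar>f x\<bar> powr 2)" by (simp add: parseval powr_numeral)
  also have "\<dots> \<le> cube_avg n (\<lambda>x. \<bar>f x\<bar> powr p)"
    using f p by (intro cube_avg_mono powr_mono') auto
  finally show ?thesis .
qed

lemma C_lower: "1 \<le> p \<Longrightarrow> p < 2 \<Longrightarrow> 1 / 2 * (2 - p) \<le> C p"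
proof -
  assume p: "1 \<le> p" "p < 2"
  have e: "exp 1 \<ge> (1::real)" by simp
  have "C p = (2 - p) / ((2 - p) + 1 / exp 1)"
    unfolding C_def using p by (simp add: field_simps)
  moreover have "(2 - p) + 1 / exp 1 \<le> 2" "(2 - p) + 1 / exp 1 > 0"
    using p add_mono[of "2 - p" 1 "1 / exp 1" 1] e by (auto intro!: add_pos_pos)
  ultimately show ?thesis
    using p divide_left_mono[of "(2 - p) + 1 / exp 1" 2 "2 - p"] by simp
qed

theorem theorem1p7:
  shows "(\<forall>n::nat. n \<ge> 1 \<longrightarrow>
      (\<forall>k\<in>{0..n}. \<forall>f \<in> cube n \<rightarrow> {-1..1}. \<forall>p\<in>{1..<2}.
        Max ((\<lambda>J. Lp_norm n p (D_set J f) powr p) ` {J. J \<subseteq> {1..n} \<and> card J = k})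
          \<ge> C p ^ k * (W_ge n k f / real (n choose k)) *
             (1 + 1 / (2 * real k) * ln (real (n choose k) / W_ge n k f)) ^ k))
    \<and> (\<exists>c>0. \<forall>p\<in>{1..<2}. C p \<ge> c * (2 - p))"
proof (intro conjI allI impI ballI)
  fix n k :: nat and f :: "(nat \<Rightarrow> real) \<Rightarrow> real" and p :: real
  assume "k \<in> {0..n}" "f \<in> cube n \<rightarrow> {-1..1}" "p \<in> {1..<2}"
  then have k: "k \<le> n" and f: "\<And>x. x \<in> cube n \<Longrightarrow> \<bar>f x\<bar> \<le> 1" and p: "1 \<le> p" "p < 2"
    by (auto simp: Pi_iff abs_le_iff)
  define \<J> where "\<J> = {J. J \<subseteq> {1..n} \<and> card J = k}"
  define m where "m = (\<lambda>J. cube_avg n (\<lambda>x. \<bar>D_set J f x\<bar> powr p))"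
  have fin: "finite \<J>" unfolding \<J>_def by (rule finite_subset[of _ "Pow {1..n}"]) auto
  have "{1..k} \<in> \<J>" using k by (auto simp: \<J>_def)
  then have ne: "\<J> \<noteq> {}" by auto
  have Max: "Max ((\<lambda>J. Lp_norm n p (D_set J f) powr p) ` \<J>) = Max (m ` \<J>)"
    using p by (simp add: Lp_norm_powr m_def)
  have "C p ^ k * (W_ge n k f / real (n choose k)) *
      (1 + 1 / (2 * real k) * ln (real (n choose k) / W_ge n k f)) ^ k \<le> Max (m ` \<J>)"
  proof (cases k)
    case 0
    then have "\<J> = {{}}" by (auto simp: \<J>_def finite_subset)
    then show ?thesis using level_inequality_0[of n f p] f p 0 by (simp add: m_def D_set_empty)
  next
    case (Suc k')
    have m_le: "m J \<le> Max (m ` \<J>)" if "J \<in> \<J>" for J using fin that by simp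
    have "m J \<le> 1" if "J \<in> \<J>" for J
    proof -
      have "m J \<le> cube_avg n (\<lambda>_. 1)"
        unfolding m_def using D_set_bounded[of n f J] f that p
        by (intro cube_avg_mono powr_le1) (auto simp: \<J>_def)
      then show ?thesis by simp
    qed
    then have "Max (m ` \<J>) \<le> 1" using fin ne by simp
    moreover have "0 \<le> Max (m ` \<J>)"
      using m_le[OF \<open>{1..k} \<in> \<J>\<close>] cube_avg_nonneg[of n "\<lambda>x. \<bar>D_set {1..k} f x\<bar> powr p"]
      by (simp add: m_def)
    ultimately show ?thesis
      unfolding Suc using k f p m_le Suc
      by (intro level_inequality_pos) (auto simp: \<J>_def m_def)
  qed
  then show "C p ^ k * (W_ge n k f / real (n choose k)) *
      (1 + 1 / (2 * real k) * ln (real (n choose k) / W_ge n k f)) ^ k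
    \<le> Max ((\<lambda>J. Lp_norm n p (D_set J f) powr p) ` {J. J \<subseteq> {1..n} \<and> card J = k})"
    using Max by (simp add: \<J>_def)
next
  show "\<exists>c>0. \<forall>p\<in>{1..<2}. c * (2 - p) \<le> C p"
    using C_lower by (intro exI[of _ "1 / 2"]) auto
qed

end
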